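(* Every standard circular graph $A=((0_{2k},a_1,\dots,a_n))$ with $k,n\ge 0$ and $a_1,\dots,a_n\le -2$ is unique in its birational equivalence class up to cyclic permutation and reversion of the sequence $(a_1,\dots,a_n)$; that is, every standard circular graph birationally equivalent to $A$ is of the form $((0_{2k},a'_1,\dots,a'_n))$ where $(a'_1,\dots,a'_n)$ is obtained from $(a_1,\dots,a_n)$ by a cyclic permutation and possibly reversion. Moreover, the standard circular graphs $((0_l,w))$ ($l\ge 0$, $w\le 0$) and $((0_{2k},-1,-1))$ ($k\ge 1$) are also unique in their birational equivalence classes.
   Context: Graphs are finite, nonempty, connected, loops and multiple edges allowed, each vertex having an integer weight. $((w_0,\dots,w_n))$ denotes the circular graph (cycle) with cyclically ordered vertices of weights $w_0,\dots,w_n$; $((w))$ is one vertex with a loop, $((w_0,w_1))$ is two vertices joined by two edges. Inside brackets $0_m$ denotes $m$ consecutive entries $0$. An inner blowup at an edge $e$ with end points $v_0,v_1$ subdivides $e$ by a new vertex of weight $-1$ and decreases the weights of $v_0$ and $v_1$ by $1$ (if $e$ is a loop, $v_0=v_1$, the weight of $v_0$ decreases by $2$). An outer blowup at a vertex $v_0$ adds a new vertex of weight $-1$ joined to $v_0$ by one new edge and decreases the weight of $v_0$ by $1$. The inverse operations are blowdowns. Two weighted graphs are birationally equivalent if one can be transformed into the other by a finite sequence of blowups and blowdowns. Standard circular graphs are the graphs $((0_{2k},w_1,\dots,w_n))$, $((0_l,w))$, $((0_{2k},-1,-1))$ with $k,l\ge 0$, $n>0$, $w\le 0$, $w_1,\dots,w_n\le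 -2$ (for $w=0$ the second is $((0_{l+1}))$). Uniqueness is understood among standard circular graphs, up to isomorphism of weighted graphs. *)

theory Defs
  imports "HOL-Library.Uprod" "HOL-Library.Multiset"
begin

text \<open>
  Weighted multigraphs with loops: edges form a multiset of unordered pairs, a loop at \<open>v\<close> being
  \<open>Upair v v\<close>.  The value of \<open>weight\<close> outside \<open>verts\<close> is irrelevant (it is ignored by isomorphism).
\<close>

record 'v wgraph =
  verts :: "'v set"
  edges :: "'v uprod multiset"
  weight :: "'v \<Rightarrow> int"

definition weighted_graph :: "'v wgraph \<Rightarrow> bool" where
  "weighted_graph G \<longleftrightarrow>
     finite (verts G) \<and> verts G \<noteq> {} \<and>
     (\<forall>e \<in># edges G. set_uprod e \<subseteq> verts G) \<and>
     (\<forall>u \<in> verts G. \<forall>v \<in> verts G. (\<lambda>x y. Upair x y \<in># edges G)\<^sup>*\<^sup>* u v)"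

definition wgraph_iso :: "'v wgraph \<Rightarrow> 'w wgraph \<Rightarrow> bool"  (infix \<open>\<cong>\<^sub>w\<close> 50) where
  "G \<cong>\<^sub>w H \<longleftrightarrow>
     (\<exists>f. bij_betw f (verts G) (verts H) \<and>
          image_mset (map_uprod f) (edges G) = edges H \<and>
          (\<forall>v \<in> verts G. weight H (f v) = weight G v))"

text \<open>
  In an inner blowup the two indicator terms add up when \<open>v\<^sub>0 = v\<^sub>1\<close>, so that blowing up a loop
  decreases the weight of its vertex by 2.
\<close>

inductive blowup :: "'v wgraph \<Rightarrow> 'v wgraph \<Rightarrow> bool" where
  inner: "\<lbrakk>Upair v\<^sub>0 v\<^sub>1 \<in># edges G; u \<notin> verts G\<rbrakk> \<Longrightarrow>
    blowup G \<lparr>verts = insert u (verts G),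
              edges = edges G - {#Upair v\<^sub>0 v\<^sub>1#} + {#Upair v\<^sub>0 u, Upair u v\<^sub>1#},
              weight = (\<lambda>v. if v = u then -1
                            else weight G v - of_bool (v = v\<^sub>0) - of_bool (v = v\<^sub>1))\<rparr>"
| outer: "\<lbrakk>v\<^sub>0 \<in> verts G; u \<notin> verts G\<rbrakk> \<Longrightarrow>
    blowup G \<lparr>verts = insert u (verts G),
              edges = edges G + {#Upair v\<^sub>0 u#},
              weight = (\<lambda>v. if v = u then -1 else weight G v - of_bool (v = v\<^sub>0))\<rparr>"

text \<open>
  Blowups and blowdowns are operations on isomorphism classes, so relabelling of vertices is
  allowed at every step.  Vertices are natural numbers, which suffices for finite graphs and
  guarantees that a new vertex is always available.
\<close>

definition birational_step :: "nat wgraph \<Rightarrow> nat wgraph \<Rightarrow> bool" where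
  "birational_step G H \<longleftrightarrow>
     weighted_graph G \<and> weighted_graph H \<and> (G \<cong>\<^sub>w H \<or> blowup G H \<or> blowup H G)"

definition birational :: "nat wgraph \<Rightarrow> nat wgraph \<Rightarrow> bool" where
  "birational = birational_step\<^sup>*\<^sup>*"

text \<open>
  The circular graph of a nonempty weight sequence.  Length 1 gives a vertex with a loop, and
  length 2 gives two vertices joined by two edges, because \<open>Upair 0 1\<close> then occurs twice.
\<close>

definition circular :: "int list \<Rightarrow> nat wgraph" where
  "circular ws =
     \<lparr>verts = {..<length ws},
      edges = {#Upair i (Suc i mod length ws). i \<in># mset [0..<length ws]#},
      weight = (\<lambda>i. ws ! i)\<rparr>"

inductive_set standard_seqs :: "int list set" where
  "\<lbrakk>ws \<noteq> []; \<forall>w \<in> set ws. w \<le> -2\<rbrakk> \<Longrightarrow> replicate (2 * k) 0 @ ws \<in> standard_seqs"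
| "w \<le> 0 \<Longrightarrow> replicate l 0 @ [w] \<in> standard_seqs"
| "replicate (2 * k) 0 @ [-1, -1] \<in> standard_seqs"

definition standard_circular :: "nat wgraph \<Rightarrow> bool" where
  "standard_circular G \<longleftrightarrow> (\<exists>ws \<in> standard_seqs. G \<cong>\<^sub>w circular ws)"

lemma weighted_graph_circular:
  assumes "ws \<noteq> []"
  shows "weighted_graph (circular ws)"
proof -
  define n where "n = length ws"
  define R where "R = (\<lambda>x y. Upair x y \<in># edges (circular ws))"
  have n: "n > 0" using assms by (simp add: n_def)
  have step: "R i (Suc i)" "R (Suc i) i" if "Suc i < n" for i
    using that by (auto simp: R_def circular_def n_def image_iff intro!: bexI[of _ i])
  have "R\<^sup>*\<^sup>* 0 i \<and> R\<^sup>*\<^sup>* i 0" if "i < n" for i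
    using that
  proof (induction i)
    case (Suc i)
    then show ?case
      using step[of i] by (meson Suc_lessD converse_rtranclp_into_rtranclp rtranclp.rtrancl_into_rtrancl)
  qed simp
  then have "R\<^sup>*\<^sup>* i j" if "i < n" "j < n" for i j
    using that by (meson rtranclp_trans)
  then show ?thesis
    using n unfolding weighted_graph_def R_def
    by (auto simp: circular_def n_def)
qed

end

theory Submission
  imports Defs "HOL-Library.Confluence" Complex_Main
begin

text \<open>
  Eliminating the trees attached to the cycle from the intersection form gives every cycle vertex an
  effective weight, and every tree vertex a negative one.  Blowups and blowdowns off the cycle, as
  well as outer ones, leave the effective weights on the cycle unchanged, while the remaining ones act
  on the cyclic sequence of effective weights by inner blowups.  Hence birational circular graphs have
  weight sequences which are related by inner blowups and blowdowns alone.

  These preserve the conjugacy class of the monodromy, a product of matrices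
  \<open>[[0, -1], [1, -w]]\<close> considered in \<open>PSL(2, \<int>)\<close>, and the number obtained by adding 3 times the length
  to the sum of the weights.  As \<open>PSL(2, \<int>)\<close> is a free product of cyclic groups of orders 2 and 3,
  conjugacy classes correspond to cyclically reduced words up to rotation, and the cyclically reduced
  word of a standard sequence determines it up to rotation and the number of zeros; the latter is then
  read off the number above.
\<close>

section \<open>Cyclic words in the modular group\<close>

text \<open>A birational path may pass through graphs with branches, and a blowdown need not undo an
  earlier blowup of the path. So each single step, in either direction, is shown to carry one
  cycle-with-trees structure to another. Negativity of the tree weights belongs to that structure
  because the elimination divides by them. On trees effective weights need not be integers, but on
  the cycle they change only by integers.

  The 3 in the charge is dictated by an inner blowup: one more vertex, while the weights lose 1 at
  the new vertex and 2 at its neighbours. Two zeros contribute the matrix -1, trivial in PSL(2, Z),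
  so the word cannot see them, but the charge grows by 6.

  Words are compared along an oriented cycle. A circular graph can be read in two directions, and
  this is the only source of the reversion in the conclusion.\<close>

definition necklace :: "'a list \<Rightarrow> 'a list set" where
  "necklace x = {q @ p | p q. x = p @ q}"

lemma necklace_iff_rotate: "y \<in> necklace x \<longleftrightarrow> (\<exists>m. y = rotate m x)"
proof
  assume "y \<in> necklace x"
  then obtain p q where "x = p @ q" "y = q @ p" by (auto simp: necklace_def)
  then have "y = rotate (length p) x" by (simp add: rotate_append)
  then show "\<exists>m. y = rotate m x" ..
next
  assume "\<exists>m. y = rotate m x"
  then obtain m where "y = rotate m x" ..
  then have "y = drop (m mod length x) x @ take (m mod length x) x"
    by (simp add: rotate_drop_take)
  then show "y \<in> necklace x"
    unfolding necklace_def by (metis (mono_tags, lifting) append_take_drop_id mem_Collect_eq)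
qed

lemma self_in_necklace: "x \<in> necklace x"
  unfolding necklace_iff_rotate by (metis rotate0 id_apply)

lemma necklace_eqI:
  assumes "y \<in> necklace x"
  shows "necklace y = necklace x"
proof -
  obtain m where m: "y = rotate m x" using assms necklace_iff_rotate by blast
  have "x = rotate (length x - m mod length x) y"
  proof (cases "x = []")
    case False
    then have "m mod length x < length x" by simp
    then have "rotate (length x - m mod length x) (rotate (m mod length x) x) = x"
      by (simp add: rotate_rotate)
    then show ?thesis using m rotate_conv_mod by metis
  qed (simp add: m)
  then show ?thesis
    unfolding set_eq_iff necklace_iff_rotate using m rotate_rotate by metis
qed

lemma necklace_append: "necklace (p @ q) = necklace (q @ p)"
  by (rule necklace_eqI) (auto simp: necklace_def)

lemma necklace_eq_iff: "necklace x = necklace y \<longleftrightarrow> (\<exists>m. x = rotate m y)"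
  using necklace_eqI necklace_iff_rotate self_in_necklace by blast

text \<open>\<open>S\<close> and \<open>U\<close> are the generators of orders 2 and 3 of the modular group
  \<open>PSL(2, \<int>)\<close>, the free product of two cyclic groups.\<close>

datatype letter = S | U

definition relators :: "letter list set" where
  "relators = {[S, S], [U, U, U]}"

text \<open>A necklace can be rotated so that any relator occurring in it, possibly across the seam,
  comes first; hence one rule without context suffices.\<close>

inductive reduces :: "letter list set \<Rightarrow> letter list set \<Rightarrow> bool" where
  "r \<in> relators \<Longrightarrow> reduces (necklace (r @ z)) (necklace z)"

text \<open>Each relator is a power of one letter, and no two share that letter; this is what makes
  overlapping occurrences harmless.\<close>

lemma relator_cases:
  assumes "r \<in> relators"
  obtains c n where "r = replicate (Suc n) c" "\<And>s z. s \<in> relators \<Longrightarrow> s = c # z \<Longrightarrow> s = r"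
proof (cases "r = [S, S]")
  case True
  then show ?thesis by (intro that[of 1 S]) (auto simp: relators_def numeral_eq_Suc)
next
  case False
  then have "r = [U, U, U]" using assms by (auto simp: relators_def)
  then show ?thesis by (intro that[of 2 U]) (auto simp: relators_def numeral_eq_Suc)
qed

text \<open>If \<open>x\<close> is no longer than the power, both words are powers of
  \<open>c\<close> of the same length; otherwise \<open>x\<close> is
  \<open>replicate n c @ t\<close> and \<open>y\<close> is \<open>t @ replicate n c\<close>.\<close>

lemma necklace_conjugate_power:
  assumes "x @ replicate n c = replicate n c @ y"
  shows "necklace x = necklace y"
proof (cases "length x \<le> n")
  case True
  have "set (x @ replicate n c) \<subseteq> {c} \<and> set y \<subseteq> {c}"
  proof -
    have "x = take (length x) (replicate n c @ y)" using assms by (metis append_eq_conv_conj)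
    then have "x = replicate (length x) c" using True by simp
    then have "set x = set (replicate (length x) c)" by (rule arg_cong)
    also have "\<dots> \<subseteq> {c}" by (simp add: set_replicate_conv_if)
    finally have 1: "set x \<subseteq> {c}" .
    have "set y \<subseteq> set (x @ replicate n c)" unfolding assms by simp
    then show ?thesis using 1 by (auto simp: set_replicate_conv_if split: if_splits)
  qed
  moreover have "length x = length y" using arg_cong[OF assms, of length] by simp
  ultimately have xy: "x = replicate (length y) c" "y = replicate (length y) c"
    by (auto intro!: replicate_eqI)
  have "x = y" by (rule trans[OF xy(1) xy(2)[symmetric]])
  then show ?thesis by simp
next
  case False
  with arg_cong[OF assms, of "take n"] have "take n x = replicate n c" by simp
  then obtain t where t: "x = replicate n c @ t" by (metis append_take_drop_id)
  from assms[unfolded t] have "y = t @ replicate n c" by simp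
  then show ?thesis using t necklace_append by metis
qed

text \<open>Two occurrences of relators in a cyclic word are either disjoint or overlap in powers of the
  same letter.\<close>

lemma reduces_overlap:
  assumes r: "r1 \<in> relators" "r2 \<in> relators"
    and eq: "r1 @ z1 = p @ q" "r2 @ z2 = q @ p" and len: "length p < length r1"
  shows "necklace z1 = necklace z2"
proof -
  obtain c n where c: "r1 = replicate (Suc n) c"
    and same: "\<And>s z. s \<in> relators \<Longrightarrow> s = c # z \<Longrightarrow> s = r1"
    using relator_cases[OF r(1)] by metis
  have "p = take (length p) (replicate (Suc n) c @ z1)"
    using eq(1) c by (metis append_eq_conv_conj)
  then have p: "p = replicate (length p) c" using len c
    by (metis length_replicate less_imp_le min_def take_append take_replicate
        diff_is_0_eq take_0 append_Nil2)
  obtain q' where q': "q = replicate (Suc n - length p) c @ z1" 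
  proof -
    have "r1 = replicate (length p) c @ replicate (Suc n - length p) c"
      using len c by (simp add: replicate_add[symmetric] del: replicate_Suc)
    then have "p @ replicate (Suc n - length p) c @ z1 = p @ q" using eq(1) p
      by (metis append.assoc)
    then show ?thesis using that by simp
  qed
  \<comment> \<open>\<open>p\<close> is shorter than \<open>r1\<close>, so at least one
    \<open>c\<close> is left at the head of \<open>q\<close>; this forces \<open>r2\<close> to begin
    with \<open>c\<close> and hence to equal \<open>r1\<close>.\<close>
  obtain m where m: "Suc n - length p = Suc m" using len c
    by (metis Suc_diff_Suc diff_zero length_replicate less_Suc_eq_0_disj zero_less_diff)
  have "r2 \<noteq> []" using r by (auto simp: relators_def)
  then have "r2 = c # tl r2" using eq(2) q' m by (cases r2) auto
  then have "r2 = r1" using same r by blast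
  then have "replicate (Suc n) c @ z2 = replicate (Suc n - length p) c @ z1 @ p"
    using eq(2) q' c by simp
  moreover have "replicate (Suc n) c = replicate (Suc n - length p) c @ replicate (length p) c"
    using len c by (simp add: replicate_add[symmetric] del: replicate_Suc)
  ultimately have "replicate (length p) c @ z2 = z1 @ replicate (length p) c"
    using p by (metis append.assoc same_append_eq)
  then show ?thesis using necklace_conjugate_power by metis
qed

text \<open>Cutting the circle at the starts of the two relators gives the arcs \<open>p\<close> and
  \<open>q\<close>. Overlapping occurrences already yield the same necklace; for disjoint ones each
  side removes the other relator in one more step.\<close>

lemma strong_confluentp_reduces: "strong_confluentp reduces"
proof
  fix x y z assume "reduces x y" "reduces x z"
  then obtain r1 z1 r2 z2 where r: "r1 \<in> relators" "r2 \<in> relators"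
    and x: "necklace (r1 @ z1) = necklace (r2 @ z2)"
    and yz: "y = necklace z1" "z = necklace z2"
    by (auto simp: reduces.simps)
  then have "r2 @ z2 \<in> necklace (r1 @ z1)" using self_in_necklace by metis
  then obtain p q where pq: "r1 @ z1 = p @ q" "r2 @ z2 = q @ p"
    by (auto simp: necklace_def)
  consider "length p < length r1" | "length q < length r2"
    | "length r1 \<le> length p" "length r2 \<le> length q" by linarith
  then show "\<exists>u. reduces\<^sup>*\<^sup>* y u \<and> reduces\<^sup>=\<^sup>= z u"
  proof cases
    case 1
    then show ?thesis using reduces_overlap[OF r pq] yz by blast
  next
    case 2
    then have "necklace z2 = necklace z1" using reduces_overlap[OF r(2,1) pq(2,1)] by blast
    then show ?thesis using yz by blast
  next
    case 3
    obtain p' where p': "p = r1 @ p'" "z1 = p' @ q"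
      using pq(1) 3 by (auto simp: append_eq_append_conv2)
    obtain q' where q': "q = r2 @ q'" "z2 = q' @ p"
      using pq(2) 3 by (auto simp: append_eq_append_conv2)
    have "y = necklace (r2 @ q' @ p')" "z = necklace (r1 @ p' @ q')"
      using yz p' q' necklace_append[of p' "r2 @ q'"] necklace_append[of q' "r1 @ p'"] by auto
    moreover have "necklace (p' @ q') = necklace (q' @ p')" by (rule necklace_append)
    ultimately have "reduces y (necklace (q' @ p'))" "reduces z (necklace (q' @ p'))"
      using reduces.intros[OF r(2), of "q' @ p'"] reduces.intros[OF r(1), of "p' @ q'"] by auto
    then show ?thesis by blast
  qed
qed

abbreviation conjugate :: "letter list set \<Rightarrow> letter list set \<Rightarrow> bool" where
  "conjugate \<equiv> equivclp reduces"

definition cyc_reduced :: "letter list \<Rightarrow> bool" where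
  "cyc_reduced x \<longleftrightarrow> (\<forall>r\<in>relators. \<forall>z. r @ z \<notin> necklace x)"

text \<open>Confluence provides a common reduct, and a cyclically reduced word is irreducible, so
  both necklaces equal it. This solves the conjugacy problem in the free product.\<close>

lemma conjugate_cyc_reduced:
  assumes "conjugate (necklace x) (necklace y)" "cyc_reduced x" "cyc_reduced y"
  shows "necklace x = necklace y"
proof -
  have irr: "M = necklace v" if "reduces\<^sup>*\<^sup>* (necklace v) M" "cyc_reduced v" for M v
  proof -
    have "\<not> reduces (necklace v) N" for N
      using that(2) self_in_necklace unfolding reduces.simps cyc_reduced_def by metis
    with that(1) show ?thesis by (blast elim: converse_rtranclpE)
  qed
  have "semiconfluentp reduces"
    using strong_confluentp_reduces strong_confluentp_into_semiconfluentp by blast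
  from semiconfluentp_equivclp[OF this] assms(1)
  obtain M where "reduces\<^sup>*\<^sup>* (necklace x) M" "reduces\<^sup>*\<^sup>* (necklace y) M"
    by (auto simp: rtranclp_conversep)
  then show ?thesis using irr assms by metis
qed

text \<open>Conjugacy is not compatible with concatenation. Demanding it in every context yields a
  congruence, which serves as equality in the modular group.\<close>

definition word_eq :: "letter list \<Rightarrow> letter list \<Rightarrow> bool" (infix \<open>\<approx>\<close> 50) where
  "x \<approx> y \<longleftrightarrow> (\<forall>p q. conjugate (necklace (p @ x @ q)) (necklace (p @ y @ q)))"

lemma word_eq_refl [simp, intro!]: "x \<approx> x" by (simp add: word_eq_def)
lemma word_eq_sym [sym]: "x \<approx> y \<Longrightarrow> y \<approx> x" by (auto simp: word_eq_def intro: equivclp_sym)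
lemma word_eq_trans [trans]: "x \<approx> y \<Longrightarrow> y \<approx> z \<Longrightarrow> x \<approx> z"
  unfolding word_eq_def by (meson equivclp_trans)
lemma word_eq_append: "x \<approx> x' \<Longrightarrow> y \<approx> y' \<Longrightarrow> x @ y \<approx> x' @ y'"
  unfolding word_eq_def by (metis append.assoc equivclp_trans)
lemma word_eq_conjugate: "x \<approx> y \<Longrightarrow> conjugate (necklace x) (necklace y)"
  unfolding word_eq_def by (metis append_Nil append_Nil2)

lemma word_eq_relator: "r \<in> relators \<Longrightarrow> r \<approx> []"
  unfolding word_eq_def
proof (intro allI)
  fix p q assume "r \<in> relators"
  then have "reduces (necklace (r @ q @ p)) (necklace (q @ p))" by (rule reduces.intros)
  then show "conjugate (necklace (p @ r @ q)) (necklace (p @ [] @ q))"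
    by (metis append.assoc append_Nil necklace_append r_into_equivclp)
qed

text \<open>Reduction in the free product by one pass from the right; it turns identities between
  explicit words into evaluation by the simplifier.\<close>

fun cancel :: "letter list \<Rightarrow> letter list" where
  "cancel [] = []"
| "cancel (S # x) = (case cancel x of S # y \<Rightarrow> y | y \<Rightarrow> S # y)"
| "cancel (U # x) = (case cancel x of U # U # y \<Rightarrow> y | y \<Rightarrow> U # y)"

lemma word_eq_cancel: "x \<approx> cancel x"
proof (induction x rule: cancel.induct)
  case (2 x)
  have "S # x \<approx> S # cancel x" using word_eq_append[OF word_eq_refl 2, of "[S]"] by simp
  moreover have "S # S # y \<approx> y" for y
    using word_eq_append[OF word_eq_relator word_eq_refl, of "[S, S]"] by (simp add: relators_def)
  ultimately have "S # x \<approx> S # cancel x" "S # x \<approx> y" if "cancel x = S # y" for y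
    using that word_eq_trans by (simp, metis)
  then show ?case using \<open>S # x \<approx> S # cancel x\<close> by (auto split: list.split letter.split)
next
  case (3 x)
  have "U # x \<approx> U # cancel x" using word_eq_append[OF word_eq_refl 3, of "[U]"] by simp
  moreover have "U # U # U # y \<approx> y" for y
    using word_eq_append[OF word_eq_relator word_eq_refl, of "[U, U, U]"] by (simp add: relators_def)
  ultimately have "U # x \<approx> U # cancel x" "U # x \<approx> y" if "cancel x = U # U # y" for y
    using that word_eq_trans by (simp, metis)
  then show ?case using \<open>U # x \<approx> U # cancel x\<close> by (auto split: list.split letter.split)
qed simp

lemma word_eqI: "cancel x = cancel y \<Longrightarrow> x \<approx> y"
  by (rule word_eq_trans[OF word_eq_cancel]) (simp add: word_eq_sym[OF word_eq_cancel])

section \<open>Monodromy of a weight sequence\<close>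

text \<open>With \<open>T = S U\<close>, \<open>shear w\<close> represents \<open>T\<close> to the power \<open>- w\<close>, and a weight \<open>w\<close> contributes the
  monodromy factor \<open>shear w @ [S]\<close>.\<close>

definition shear :: "int \<Rightarrow> letter list" where
  "shear w = (if w \<le> 0 then concat (replicate (nat (- w)) [S, U])
              else concat (replicate (nat w) [U, U, S]))"

definition word :: "int list \<Rightarrow> letter list" where
  "word ws = concat (map (\<lambda>w. shear w @ [S]) ws)"

lemma word_simps [simp]:
  "word [] = []" "word (w # ws) = shear w @ S # word ws" "word (xs @ ys) = word xs @ word ys"
  by (simp_all add: word_def)

lemma concat_replicate_shift: "concat (replicate n xs) @ xs = xs @ concat (replicate n xs)"
  by (induction n) auto

text \<open>With T = S U, lowering the weight by 1 multiplies by T, on either side since powers of T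
  commute. For positive \<open>w\<close> the extra T meets its inverse U U S and cancels by the
  relators.\<close>

lemma shear_dec: "shear (w - 1) \<approx> [S, U] @ shear w" "shear (w - 1) \<approx> shear w @ [S, U]"
proof -
  show "shear (w - 1) \<approx> [S, U] @ shear w"
  proof (cases "w \<le> 0")
    case True
    then have "nat (- (w - 1)) = Suc (nat (- w))" by simp
    then show ?thesis using True by (simp add: shear_def)
  next
    case False
    then have "nat w = Suc (nat (w - 1))" by simp
    then have "[S, U] @ shear w = [S, U, U, U, S] @ shear (w - 1)" using False
      by (simp add: shear_def)
    moreover have "[S, U, U, U, S] @ shear (w - 1) \<approx> [] @ shear (w - 1)"
      by (intro word_eq_append word_eqI) auto
    ultimately show ?thesis using word_eq_sym by simp
  qed
  show "shear (w - 1) \<approx> shear w @ [S, U]"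
  proof (cases "w \<le> 0")
    case True
    then have "nat (- (w - 1)) = Suc (nat (- w))" by simp
    then show ?thesis using True concat_replicate_shift[of _ "[S, U]"] by (simp add: shear_def)
  next
    case False
    then have "nat w = Suc (nat (w - 1))" by simp
    then have "shear w @ [S, U] = shear (w - 1) @ [U, U, S, S, U]" using False
      concat_replicate_shift[of "nat (w - 1)" "[U, U, S]"] by (simp add: shear_def)
    moreover have "shear (w - 1) @ [U, U, S, S, U] \<approx> shear (w - 1) @ []"
      by (intro word_eq_append word_eqI) auto
    ultimately show ?thesis using word_eq_sym by simp
  qed
qed

text \<open>Passing to \<open>PSL(2, \<int>)\<close> forgets the winding number; the charge, an analogue of the Rademacher
  function, recovers it.\<close>

definition charge :: "int list \<Rightarrow> int" where
  "charge ws = sum_list ws + 3 * int (length ws)"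

text \<open>Only the two invariants are compared and no chain of blowups is recorded, which makes
  this an equivalence relation at once.\<close>

definition inner_equiv :: "int list \<Rightarrow> int list \<Rightarrow> bool" where
  "inner_equiv ws ws' \<longleftrightarrow>
     conjugate (necklace (word ws)) (necklace (word ws')) \<and> charge ws = charge ws'"

lemma inner_equiv_refl [simp]: "inner_equiv ws ws"
  by (simp add: inner_equiv_def)
lemma inner_equiv_sym: "inner_equiv ws ws' \<Longrightarrow> inner_equiv ws' ws"
  by (auto simp: inner_equiv_def intro: equivclp_sym)
lemma inner_equiv_trans: "inner_equiv ws ws' \<Longrightarrow> inner_equiv ws' ws'' \<Longrightarrow> inner_equiv ws ws''"
  unfolding inner_equiv_def by (metis equivclp_trans)

lemma inner_equiv_append: "inner_equiv (xs @ ys) (ys @ xs)"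
  unfolding inner_equiv_def by (simp add: charge_def necklace_append)

lemma inner_equiv_rotate: "inner_equiv ws (rotate m ws)"
  using inner_equiv_append[of "take (m mod length ws) ws" "drop (m mod length ws) ws"]
  by (simp add: rotate_drop_take)

text \<open>A cyclic inner blowup of the edge joining the last entry to the first one.\<close>

definition blow_seam :: "int list \<Rightarrow> int list" where
  "blow_seam ws = (let v = ws[0 := hd ws - 1] in - 1 # v[length ws - 1 := last v - 1])"

text \<open>The two decrements are made one after the other, so on a single entry both fall on it,
  as for a loop.\<close>

lemma blow_seam_simps:
  "blow_seam [a] = [- 1, a - 2]"
  "blow_seam (a # ws @ [b]) = - 1 # (a - 1) # ws @ [b - 1]"
  by (simp_all add: blow_seam_def Let_def)

text \<open>Pulling one \<open>[S, U]\<close> out of each decremented shear leaves S U S S U S S U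
  between the old neighbours across the seam, and this collapses to the single S that stood there
  before.\<close>

lemma inner_equiv_blow_seam:
  assumes "ws \<noteq> []"
  shows "inner_equiv ws (blow_seam ws)"
proof -
  have m1: "shear (- 1) = [S, U]" by (simp add: shear_def)
  consider a where "ws = [a]" | a xs b where "ws = a # xs @ [b]"
    using assms by (metis neq_Nil_conv rev_exhaust)
  then show ?thesis
  proof cases
    case (1 a)
    have "shear (a - 2) \<approx> shear (a - 1) @ [S, U]"
      using shear_dec(2)[of "a - 1"] by simp
    also have "\<dots> \<approx> ([S, U] @ shear a) @ [S, U]"
      by (intro word_eq_append shear_dec) auto
    finally have "[S, U, S] @ shear (a - 2) @ [S] \<approx> [S, U, S] @ (([S, U] @ shear a) @ [S, U]) @ [S]"
      by (intro word_eq_append) auto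
    then have "conjugate (necklace (word (blow_seam ws)))
        (necklace ([S, U, S, S, U] @ (shear a @ [S, U, S])))"
      using 1 m1 by (auto simp: blow_seam_simps dest!: word_eq_conjugate)
    \<comment> \<open>The factors split off at the two ends of the word meet only after a rotation
      across the seam.\<close>
    also have "necklace ([S, U, S, S, U] @ (shear a @ [S, U, S]))
       = necklace (shear a @ [S, U, S, S, U, S, S, U])"
      by (subst necklace_append) simp
    also have "conjugate \<dots> (necklace (shear a @ [S]))"
      by (intro word_eq_conjugate word_eq_append word_eqI) auto
    finally have "conjugate (necklace (word (blow_seam ws))) (necklace (word ws))" using 1 by simp
    then show ?thesis using 1
      by (auto simp: inner_equiv_def charge_def blow_seam_simps intro: equivclp_sym)
  next
    case (2 a xs b)
    have "[S, U, S] @ shear (a - 1) @ (S # word xs) @ shear (b - 1) @ [S]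
      \<approx> [S, U, S] @ ([S, U] @ shear a) @ (S # word xs) @ (shear b @ [S, U]) @ [S]"
      by (intro word_eq_append shear_dec) auto
    then have "conjugate (necklace (word (blow_seam ws)))
        (necklace ([S, U, S, S, U] @ (shear a @ S # word xs @ shear b @ [S, U, S])))"
      using 2 m1 by (auto simp: blow_seam_simps dest!: word_eq_conjugate)
    also have "necklace ([S, U, S, S, U] @ (shear a @ S # word xs @ shear b @ [S, U, S]))
       = necklace (shear a @ (S # word xs) @ shear b @ [S, U, S, S, U, S, S, U])"
      by (subst necklace_append) simp
    also have "conjugate \<dots> (necklace (shear a @ (S # word xs) @ shear b @ [S]))"
      by (intro word_eq_conjugate word_eq_append word_eqI) auto
    finally have "conjugate (necklace (word (blow_seam ws))) (necklace (word ws))" using 2 by simp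
    then show ?thesis using 2
      by (auto simp: inner_equiv_def charge_def blow_seam_simps intro: equivclp_sym)
  qed
qed

section \<open>Words cut into blocks by a marker letter\<close>

lemma concat_split_at_marker:
  assumes "concat (map (\<lambda>b. m # g b) bs) = p @ q" "q = [] \<or> hd q = m" "\<And>b. m \<notin> set (g b)"
  shows "\<exists>b1 b2. bs = b1 @ b2 \<and> p = concat (map (\<lambda>b. m # g b) b1) \<and>
                 q = concat (map (\<lambda>b. m # g b) b2)"
  using assms(1)
proof (induction bs arbitrary: p)
  case Nil
  then show ?case by auto
next
  case (Cons b bs)
  show ?case
  proof (cases p)
    case Nil
    then show ?thesis using Cons.prems by (intro exI[of _ "[]"] exI[of _ "b # bs"]) auto
  next
    case (Cons c p')
    then have "c = m" and eq: "g b @ concat (map (\<lambda>b. m # g b) bs) = p' @ q"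
      using Cons.prems by auto
    show ?thesis
    proof (cases "length (g b) \<le> length p'")
      case True
      then obtain p'' where p'': "p' = g b @ p''" and "concat (map (\<lambda>b. m # g b) bs) = p'' @ q"
        using eq by (auto simp: append_eq_append_conv2)
      then obtain b1 b2 where "bs = b1 @ b2" "p'' = concat (map (\<lambda>b. m # g b) b1)"
        "q = concat (map (\<lambda>b. m # g b) b2)" using Cons.IH by blast
      then show ?thesis using \<open>p = c # p'\<close> \<open>c = m\<close> p''
        by (intro exI[of _ "b # b1"] exI[of _ b2]) auto
    next
      case False
      then obtain t where "g b = p' @ t" "t \<noteq> []" "t @ concat (map (\<lambda>b. m # g b) bs) = q"
        using eq by (auto simp: append_eq_append_conv2)
      then have "hd q \<in> set (g b)" "q \<noteq> []" by auto
      then show ?thesis using assms(2,3) by auto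
    qed
  qed
qed

lemma concat_markers_inject:
  assumes "\<And>b. m \<notin> set (g b)" "inj g"
    and "concat (map (\<lambda>b. m # g b) bs) = concat (map (\<lambda>b. m # g b) cs)"
  shows "bs = cs"
  using assms(3)
proof (induction bs arbitrary: cs)
  case Nil
  then show ?case by (cases cs) auto
next
  case (Cons b bs)
  then obtain c cs' where cs: "cs = c # cs'" by (cases cs) auto
  let ?q = "concat (map (\<lambda>b. m # g b) bs)"
  have q: "?q = [] \<or> hd ?q = m" by (cases bs) auto
  have "concat (map (\<lambda>b. m # g b) cs) = (m # g b) @ ?q" using Cons.prems by simp
  from concat_split_at_marker[OF this q assms(1)] obtain b1 b2 where
    b: "cs = b1 @ b2" "m # g b = concat (map (\<lambda>b. m # g b) b1)"
       "?q = concat (map (\<lambda>b. m # g b) b2)" by blast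
  then obtain b' b1' where b1: "b1 = b' # b1'" by (cases b1) auto
  then have "g b = g b' @ concat (map (\<lambda>b. m # g b) b1')" using b by simp
  then have "m \<notin> set (concat (map (\<lambda>b. m # g b) b1'))" using assms(1)[of b] by (metis UnI2 set_append)
  then have "b1' = []" by (cases b1') auto
  then show ?case using b b1 Cons.IH[of b2] assms(2) by (auto dest: injD)
qed

text \<open>Markers stand exactly at the block starts, so a rotation beginning with a marker cuts
  between blocks and thus rotates the list of blocks. Applied with marker S to \<open>spell\<close>
  and with marker \<open>True\<close> to \<open>blocks\<close>.\<close>

lemma necklace_concat_markers:
  assumes "\<And>b. m \<notin> set (g b)" "inj g"
    and "necklace (concat (map (\<lambda>b. m # g b) bs)) = necklace (concat (map (\<lambda>b. m # g b) cs))"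
  shows "necklace bs = necklace cs"
proof -
  have "concat (map (\<lambda>b. m # g b) cs) \<in> necklace (concat (map (\<lambda>b. m # g b) bs))"
    using assms(3) self_in_necklace by metis
  then obtain p q where pq: "concat (map (\<lambda>b. m # g b) bs) = p @ q"
    "concat (map (\<lambda>b. m # g b) cs) = q @ p" by (auto simp: necklace_def)
  \<comment> \<open>\<open>q\<close> is an initial part of the second flattened word, so it starts
    with a marker unless it is empty.\<close>
  have "q = [] \<or> hd q = m" using pq(2) by (cases cs; cases q) auto
  from concat_split_at_marker[OF pq(1) this assms(1)] obtain b1 b2 where
    b: "bs = b1 @ b2" "p = concat (map (\<lambda>b. m # g b) b1)" "q = concat (map (\<lambda>b. m # g b) b2)"
    by blast
  then have "concat (map (\<lambda>b. m # g b) cs) = concat (map (\<lambda>b. m # g b) (b2 @ b1))"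
    using pq by simp
  then have "cs = b2 @ b1" using concat_markers_inject[OF assms(1,2)] by blast
  then show ?thesis using b necklace_append by metis
qed

section \<open>Standard sequences\<close>

text \<open>A weight \<open>- n - 2\<close> in a standard sequence contributes the reduced block \<open>S U U\<close> followed by \<open>n\<close> blocks
  \<open>S U\<close>, up to a common conjugation; \<open>blocks\<close> below records this with \<open>True\<close> for \<open>S U U\<close>.\<close>

definition spell :: "bool list \<Rightarrow> letter list" where
  "spell l = concat (map (\<lambda>b. S # (if b then [U, U] else [U])) l)"

lemma spell_simps [simp]:
  "spell [] = []" "spell (b # l) = S # (if b then [U, U] else [U]) @ spell l"
  "spell (l @ l') = spell l @ spell l'"
  by (simp_all add: spell_def)

lemma spell_replicate_False: "spell (replicate n False) = concat (replicate n [S, U])"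
  by (induction n) auto

text \<open>In a spelled word every S is isolated and runs of U have length 1 or 2.\<close>

lemma spell_no_relator:
  assumes "r \<in> relators"
  shows "spell l \<noteq> p @ r @ z"
proof (induction l arbitrary: p)
  case Nil
  then show ?case using assms by (auto simp: relators_def)
next
  case (Cons b l)
  have hd: "spell l = [] \<or> (\<exists>t. spell l = S # t)" by (cases l) auto
  show ?case
  proof
    assume eq: "spell (b # l) = p @ r @ z"
    show False
    proof (cases p)
      case Nil
      then show False using eq assms by (auto simp: relators_def split: if_splits)
    next
      case (Cons c p1)
      show False
      proof (cases p1)
        case Nil
        then show False using eq Cons assms hd by (auto simp: relators_def split: if_splits)
      next
        case p1: (Cons c' p2)
        show False
        proof (cases b)
          case False
          then show False using eq Cons p1 Cons.IH by auto
        next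
          case True
          show False
          proof (cases p2)
            case Nil
            then show False using eq Cons p1 True assms hd by (auto simp: relators_def)
          next
            case p2: (Cons c'' p3)
            then show False using eq Cons p1 True Cons.IH by auto
          qed
        qed
      qed
    qed
  qed
qed

lemma mset_necklace: "y \<in> necklace x \<Longrightarrow> mset y = mset x"
  by (auto simp: necklace_def)

lemma necklace_eq_mset: "necklace x = necklace y \<Longrightarrow> mset x = mset y"
  using mset_necklace self_in_necklace by metis

text \<open>A relator straddling the seam is an ordinary factor of the word written twice, and
  \<open>spell (l @ l)\<close> is again a spelled word.\<close>

lemma cyc_reduced_spell: "cyc_reduced (spell l)"
  unfolding cyc_reduced_def
proof (intro ballI allI notI)
  fix r z assume r: "r \<in> relators" and "r @ z \<in> necklace (spell l)"
  then obtain p q where "spell l = p @ q" "r @ z = q @ p" by (auto simp: necklace_def)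
  then have "spell (l @ l) = p @ r @ (z @ q)" by (metis append.assoc spell_simps(3))
  then show False using spell_no_relator r by metis
qed

lemma cyc_reduced_short: "cyc_reduced [S]" "cyc_reduced [U]" "cyc_reduced [U, U]"
  by (auto simp: cyc_reduced_def relators_def add_eq_conv_diff dest!: mset_necklace split: if_splits)

lemma count_spell: "count (mset (spell l)) S = length l" "count (mset (spell l)) U \<ge> length l"
  by (induction l) auto

lemma necklace_spell: "necklace (spell l) = necklace (spell l') \<Longrightarrow> necklace l = necklace l'"
  unfolding spell_def by (rule necklace_concat_markers) (auto simp: inj_def split: if_splits)

text \<open>A spelled word has at least as many U as S, which excludes \<open>[S]\<close>; without S
  it is empty, which excludes the powers of U. The three exceptions are the nontrivial torsion
  classes.\<close>

lemma necklace_spell_short: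
  assumes "x \<in> {[S], [U], [U, U]}"
  shows "necklace (spell l) \<noteq> necklace x"
proof
  assume "necklace (spell l) = necklace x"
  then have "mset (spell l) = mset x" by (rule necklace_eq_mset)
  then have "length l = count (mset x) S" "length l \<le> count (mset x) U" "length (spell l) = length x"
    using count_spell[of l] by (auto dest: mset_eq_length)
  then show False using assms by (cases l) auto
qed

definition chain_weight :: "nat \<Rightarrow> int" where
  "chain_weight n = - int n - 2"

definition blocks :: "nat list \<Rightarrow> bool list" where
  "blocks ns = concat (map (\<lambda>n. True # replicate n False) ns)"

lemma necklace_blocks: "necklace (blocks ns) = necklace (blocks ns') \<Longrightarrow> necklace ns = necklace ns'"
  unfolding blocks_def by (rule necklace_concat_markers) (auto simp: inj_def)

text \<open>The standard sequences regrouped by conjugacy class. For \<open>((0_l, w))\<close> the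
  parity of \<open>l\<close> decides: odd \<open>l\<close> gives a power of S U, even
  \<open>l\<close> gives torsion for \<open>w\<close> = 0 or -1 and a one-entry chain below that. A
  chain with all entries -2 gives a power of S U U, which is the inverse of S U up to
  conjugation.\<close>

inductive normal_form :: "int list \<Rightarrow> letter list \<Rightarrow> bool" where
  chain: "ns \<noteq> [] \<Longrightarrow>
    normal_form (replicate (2 * k) 0 @ map chain_weight ns) (spell (blocks ns))"
| odd_zeros: "normal_form (replicate (2 * k + 1) 0 @ [- int n]) (spell (replicate n False))"
| minus_one: "normal_form (replicate (2 * k) 0 @ [- 1]) [U]"
| zero: "normal_form (replicate (2 * k) 0 @ [0]) [S]"
| minus_ones: "normal_form (replicate (2 * k) 0 @ [- 1, - 1]) [U, U]"

lemma map_chain_weight: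
  assumes "\<forall>w\<in>set ws. w \<le> - 2"
  shows "\<exists>ns. ws = map chain_weight ns"
  using assms
proof (induction ws)
  case (Cons w ws)
  then obtain ns where "ws = map chain_weight ns" by auto
  moreover have "w = chain_weight (nat (- w - 2))" using Cons.prems by (simp add: chain_weight_def)
  ultimately show ?case by (metis list.simps(9))
qed simp

lemma standard_normal_form:
  assumes "ws \<in> standard_seqs"
  shows "\<exists>x. normal_form ws x"
  using assms
proof cases
  case (1 as k)
  then show ?thesis using map_chain_weight[of as] normal_form.chain by (metis list.map_disc_iff)
next
  case (2 w l)
  show ?thesis
  proof (cases "odd l")
    case True
    then obtain k where "l = 2 * k + 1" by (elim oddE)
    moreover have "w = - int (nat (- w))" using 2 by simp
    ultimately show ?thesis using 2 normal_form.odd_zeros by metis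
  next
    case False
    then have "even l" by simp
    then obtain k where k: "l = 2 * k" by (elim evenE)
    consider "w = 0" | "w = - 1" | "w \<le> - 2" using 2 by linarith
    then show ?thesis
    proof cases
      case 3
      then have "w = chain_weight (nat (- w - 2))" by (simp add: chain_weight_def)
      then show ?thesis using 2 k normal_form.chain[of "[nat (- w - 2)]" k] by auto
    qed (use 2 k normal_form.intros in blast)+
  qed
next
  case (3 k)
  then show ?thesis using normal_form.minus_ones by blast
qed

text \<open>A zero weight contributes a bare S, so two of them cancel.\<close>

lemma even_zeros: "word (replicate (2 * k) 0) \<approx> []"
proof (induction k)
  case (Suc k)
  have "[S, S] @ word (replicate (2 * k) 0) \<approx> [] @ []"
    by (intro word_eq_append Suc word_eqI) simp
  then show ?case by (simp add: shear_def)
qed simp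

lemma even_zeros_append: "word (replicate (2 * k) 0 @ ws) \<approx> word ws"
  using word_eq_append[OF even_zeros word_eq_refl, of k "word ws"] by simp

text \<open>Each weight contributes S U, then further blocks S U, then \<open>q\<close> = S U S.
  Conjugating by \<open>q\<close> moves it to the front of every factor, where S U S S U cancels to
  S U U.\<close>

lemma conjugate_chain:
  "conjugate (necklace (word (map chain_weight ns))) (necklace (spell (blocks ns)))"
proof -
  define X where "X n = concat (replicate n [S, U])" for n
  define q where "q = [S, U, S]"
  define A where "A = concat (map (\<lambda>n. [S, U] @ X n @ q) ns)"
  define B where "B = concat (map (\<lambda>n. q @ [S, U] @ X n) ns)"
  have A: "word (map chain_weight ns) = A"
  proof -
    have "shear (chain_weight n) @ [S] = [S, U] @ X n @ q" for n
    proof -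
      have "shear (chain_weight n) = [S, U] @ [S, U] @ X n"
        by (simp add: shear_def chain_weight_def X_def nat_add_distrib numeral_eq_Suc)
      then show ?thesis using concat_replicate_shift[of n "[S, U]"] by (simp add: X_def q_def)
    qed
    then show ?thesis by (simp add: word_def A_def comp_def)
  qed
  have B: "B \<approx> spell (blocks ns)"
    unfolding B_def
  proof (induction ns)
    case (Cons n ns)
    have "[S, U, S, S, U] @ X n @ concat (map (\<lambda>n. q @ [S, U] @ X n) ns)
       \<approx> [S, U, U] @ X n @ spell (blocks ns)"
      by (intro word_eq_append word_eq_refl Cons word_eqI) simp
    then show ?case by (simp add: q_def blocks_def spell_replicate_False X_def)
  qed (simp add: blocks_def)
  have qA: "q @ A = B @ q"
    unfolding A_def B_def by (induction ns) auto
  \<comment> \<open>\<open>[S, U, U, S]\<close> is the inverse of \<open>q\<close>. Placed in front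
    of \<open>q @ A\<close>, and by rotation behind \<open>B @ q\<close>, it turns
    \<open>q @ A = B @ q\<close> into a conjugation.\<close>
  have "[S, U, U, S] @ q \<approx> []" "q @ [S, U, U, S] \<approx> []"
    unfolding q_def by (intro word_eqI; simp)+
  then have "([S, U, U, S] @ q) @ A \<approx> [] @ A" "B @ (q @ [S, U, U, S]) \<approx> B @ []"
    using word_eq_append word_eq_refl by blast+
  moreover have "necklace (([S, U, U, S] @ q) @ A) = necklace (B @ (q @ [S, U, U, S]))"
    using qA necklace_append[of "[S, U, U, S]" "q @ A"] by simp
  ultimately have "conjugate (necklace A) (necklace B)"
    by (metis append_Nil append_Nil2 equivclp_sym equivclp_trans word_eq_conjugate)
  then show ?thesis unfolding A using word_eq_conjugate[OF B] equivclp_trans by metis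
qed

lemma conjugate_normal_form:
  assumes "normal_form ws x"
  shows "conjugate (necklace (word ws)) (necklace x)" "cyc_reduced x"
proof -
  show "cyc_reduced x" using assms by cases (auto intro: cyc_reduced_spell cyc_reduced_short)
  have m1: "shear (- 1) = [S, U]" "shear 0 = []" by (simp_all add: shear_def)
  show "conjugate (necklace (word ws)) (necklace x)"
    using assms
  proof cases
    case (chain ns k)
    then show ?thesis
      using word_eq_conjugate[OF even_zeros_append] conjugate_chain equivclp_trans by metis
  next
    case (odd_zeros k n)
    have "word ws = word (replicate (2 * k) 0) @ S # shear (- int n) @ [S]"
      using odd_zeros m1 by (simp add: replicate_append_same[symmetric])
    also have "\<dots> \<approx> S # shear (- int n) @ [S]"
      using word_eq_append[OF even_zeros word_eq_refl] by fastforce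
    finally have "conjugate (necklace (word ws)) (necklace (S # shear (- int n) @ [S]))"
      by (rule word_eq_conjugate)
    \<comment> \<open>The odd zero leaves one S in front; rotated to the end it cancels the S of the
      last weight, and a pure shear remains.\<close>
    also have "necklace (S # shear (- int n) @ [S]) = necklace (shear (- int n) @ [S, S])"
      using necklace_append[of "[S]" "shear (- int n) @ [S]"] by simp
    also have "conjugate \<dots> (necklace (shear (- int n) @ []))"
      by (intro word_eq_conjugate word_eq_append word_eqI) auto
    finally show ?thesis using odd_zeros by (simp add: spell_replicate_False shear_def)
  next
    case (minus_one k)
    have "conjugate (necklace (word ws)) (necklace ([S] @ [U, S]))"
      using word_eq_conjugate[OF even_zeros_append[of k "[- 1]"]] minus_one m1 by simp
    also have "necklace ([S] @ [U, S]) = necklace [U, S, S]" by (subst necklace_append) simp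
    also have "conjugate \<dots> (necklace [U])" by (intro word_eq_conjugate word_eqI) simp
    finally show ?thesis using minus_one by simp
  next
    case (zero k)
    show ?thesis
      using word_eq_conjugate[OF even_zeros_append[of k "[0]"]] zero m1 by simp
  next
    case (minus_ones k)
    have "conjugate (necklace (word ws)) (necklace ([S] @ [U, S, S, U, S]))"
      using word_eq_conjugate[OF even_zeros_append[of k "[- 1, - 1]"]] minus_ones m1 by simp
    also have "necklace ([S] @ [U, S, S, U, S]) = necklace [U, S, S, U, S, S]"
      by (subst necklace_append) simp
    also have "conjugate \<dots> (necklace [U, U])" by (intro word_eq_conjugate word_eqI) simp
    finally show ?thesis using minus_ones by simp
  qed
qed

lemma charge_simps [simp]:
  "charge (xs @ ys) = charge xs + charge ys" "charge (replicate n 0) = 3 * int n"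
  by (simp_all add: charge_def sum_list_replicate)

lemma charge_rotate: "charge (rotate m ws) = charge ws"
  using inner_equiv_rotate by (metis inner_equiv_def)

text \<open>Decoding markers twice recovers a chain up to rotation, and the charge, which grows by 6
  with each pair of zeros, then recovers \<open>k\<close>. The kinds are told apart by their letters
  and by the block S U U, present in every chain and in no power of S U.\<close>

lemma normal_form_unique:
  assumes "normal_form as x" "normal_form bs y" and xy: "necklace x = necklace y"
    and charge: "charge as = charge bs"
  shows "as = bs \<or> (\<exists>k as' m. as' \<noteq> [] \<and> (\<forall>a\<in>set as'. a \<le> - 2) \<and>
           as = replicate (2 * k) 0 @ as' \<and> bs = replicate (2 * k) 0 @ rotate m as')"
proof -
  have no: False if "necklace (blocks ns) = necklace (replicate n False)" "ns \<noteq> []" for ns n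
  proof -
    have "True \<in> set (blocks ns)" using that(2) by (cases ns) (auto simp: blocks_def)
    then show False using necklace_eq_mset[OF that(1)] by (metis in_set_replicate mset_eq_setD)
  qed
  have short: "mset x = mset y" using xy by (rule necklace_eq_mset)
  show ?thesis
    using assms(1)
  proof cases
    case as: (chain ns k)
    from assms(2) show ?thesis
    proof cases
      case bs: (chain ns' k')
      have "necklace ns' = necklace ns"
        using as bs xy necklace_spell necklace_blocks by metis
      then obtain m where m: "ns' = rotate m ns" by (auto simp: necklace_eq_iff)
      then have "bs = replicate (2 * k') 0 @ rotate m (map chain_weight ns)"
        using bs by (simp add: rotate_map)
      moreover from this have "k' = k" using charge as by (simp add: charge_rotate)
      ultimately show ?thesis using as
        by (intro disjI2 exI[of _ k] exI[of _ "map chain_weight ns"] exI[of _ m])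
           (auto simp: chain_weight_def)
    next
      case (odd_zeros k' n)
      then show ?thesis using as xy no necklace_spell by metis
    qed (use as xy necklace_spell_short in auto)
  next
    case as: (odd_zeros k n)
    from assms(2) show ?thesis
    proof cases
      case (chain ns k')
      then show ?thesis using as xy no necklace_spell by metis
    next
      case bs: (odd_zeros k' n')
      have "necklace (replicate n False) = necklace (replicate n' False)"
        using as bs xy necklace_spell by metis
      then have "n = n'" by (metis necklace_eq_mset size_mset length_replicate)
      moreover from this have "k = k'" using charge as bs by (simp add: charge_def sum_list_replicate)
      ultimately show ?thesis using as bs by simp
    qed (use as xy necklace_spell_short in auto)
  next
    case as: (minus_one k)
    from assms(2) show ?thesis
      by cases (use as charge short xy[symmetric] necklace_spell_short in \<open>auto simp: charge_def sum_list_replicate\<close>)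
  next
    case as: (zero k)
    from assms(2) show ?thesis
      by cases (use as charge short xy[symmetric] necklace_spell_short in \<open>auto simp: charge_def sum_list_replicate\<close>)
  next
    case as: (minus_ones k)
    from assms(2) show ?thesis
      by cases (use as charge short xy[symmetric] necklace_spell_short in \<open>auto simp: charge_def sum_list_replicate\<close>)
  qed
qed

lemma standard_unique:
  assumes "as \<in> standard_seqs" "bs \<in> standard_seqs" "inner_equiv as bs"
  shows "as = bs \<or> (\<exists>k as' m. as' \<noteq> [] \<and> (\<forall>a\<in>set as'. a \<le> - 2) \<and>
           as = replicate (2 * k) 0 @ as' \<and> bs = replicate (2 * k) 0 @ rotate m as')"
proof -
  obtain x y where xy: "normal_form as x" "normal_form bs y"
    using assms standard_normal_form by blast
  have "conjugate (necklace x) (necklace y)"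
    using conjugate_normal_form(1)[OF xy(1)] conjugate_normal_form(1)[OF xy(2)] assms(3)
    unfolding inner_equiv_def by (meson equivclp_sym equivclp_trans)
  then have "necklace x = necklace y"
    using conjugate_cyc_reduced conjugate_normal_form(2) xy by blast
  then show ?thesis using normal_form_unique xy assms(3) by (simp add: inner_equiv_def)
qed

section \<open>The core of a unicyclic graph\<close>

text \<open>
  A connected graph with as many edges as vertices is a cycle \<open>cs\<close> with trees attached: every
  vertex \<open>v\<close> carries one edge to its successor \<open>p v\<close>, which is the next vertex on the cycle or the
  vertex closer to the cycle.  The rank \<open>d\<close> excludes further cycles, and is real so that a subdivided
  edge always leaves room for an intermediate rank.  The effective weight \<open>x v\<close> results from
  eliminating the tree above \<open>v\<close> from the intersection form.
\<close>

locale cycle_forest =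
  fixes G :: "'v wgraph" and cs :: "'v list" and p :: "'v \<Rightarrow> 'v" and d x :: "'v \<Rightarrow> real"
  assumes finite_verts: "finite (verts G)"
    and cycle_nonempty: "cs \<noteq> []"
    and distinct_cycle: "distinct cs"
    and cycle_subset: "set cs \<subseteq> verts G"
    and parent_cycle: "map p cs = rotate1 cs"
    and parent_verts: "v \<in> verts G \<Longrightarrow> p v \<in> verts G"
    and edges: "edges G = image_mset (\<lambda>v. Upair v (p v)) (mset_set (verts G))"
    and depth: "v \<in> verts G - set cs \<Longrightarrow> d (p v) < d v"
    and negative: "v \<in> verts G - set cs \<Longrightarrow> x v < 0"
    and weight: "v \<in> verts G \<Longrightarrow>
      real_of_int (weight G v) = x v + (\<Sum>c\<in>verts G - set cs. if p c = v then 1 / x c else 0)"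
    and integral: "v \<in> set cs \<Longrightarrow> x v \<in> \<int>"
begin

lemma parent_image_cycle: "p ` set cs = set cs"
  using arg_cong[OF parent_cycle, of set] by simp

lemma parent_in_cycle: "v \<in> set cs \<Longrightarrow> p v \<in> set cs"
  using parent_image_cycle by blast

lemma parent_off_cycle: "v \<in> verts G - set cs \<Longrightarrow> p v \<noteq> v \<and> p (p v) \<noteq> v"
  using depth[of v] depth[of "p v"] parent_verts[of v] parent_in_cycle[of "p v"] by force

text \<open>The list may start anywhere on the cycle, so any cycle edge can be moved to the
  seam.\<close>

lemma rotate_cycle: "cycle_forest G (rotate m cs) p d x"
proof
  show "map p (rotate m cs) = rotate1 (rotate m cs)"
    by (simp add: rotate_map[symmetric] parent_cycle rotate1_rotate_swap)
qed (use finite_verts cycle_nonempty distinct_cycle cycle_subset parent_verts edges depth negative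
    weight integral in auto)

text \<open>Lets parent and children of a vertex be read off from its edges when blowing down. If
  \<open>p u\<close> were \<open>u\<close>, the loop would be counted twice on the right.\<close>

lemma incident_edges:
  assumes "u \<in> verts G" "p u \<noteq> u"
  shows "filter_mset (\<lambda>e. u \<in> set_uprod e) (edges G) =
    add_mset (Upair u (p u)) (image_mset (\<lambda>v. Upair v u) (mset_set {v \<in> verts G. p v = u}))"
proof -
  have "filter_mset (\<lambda>e. u \<in> set_uprod e) (edges G)
      = image_mset (\<lambda>v. Upair v (p v)) (mset_set {v \<in> verts G. u = v \<or> u = p v})"
    unfolding edges by (simp add: filter_mset_image_mset filter_mset_mset_set finite_verts)
  also have "{v \<in> verts G. u = v \<or> u = p v} = insert u {v \<in> verts G. p v = u}"
    using assms by auto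
  also have "image_mset (\<lambda>v. Upair v (p v)) (mset_set \<dots>)
     = add_mset (Upair u (p u)) (image_mset (\<lambda>v. Upair v (p v)) (mset_set {v \<in> verts G. p v = u}))"
    using assms finite_verts by simp
  also have "image_mset (\<lambda>v. Upair v (p v)) (mset_set {v \<in> verts G. p v = u})
     = image_mset (\<lambda>v. Upair v u) (mset_set {v \<in> verts G. p v = u})"
    using finite_verts by (intro image_mset_cong) auto
  finally show ?thesis .
qed

end

text \<open>\<open>x\<close> is integral on the cycle, so the floor merely changes the type.
  Starting point and direction of \<open>cs\<close> are free, so a graph may have several
  cores.\<close>

definition has_core :: "'v wgraph \<Rightarrow> int list \<Rightarrow> bool" where
  "has_core G ws \<longleftrightarrow> (\<exists>cs p d x. cycle_forest G cs p d x \<and> ws = map (\<lambda>v. \<lfloor>x v\<rfloor>) cs)"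

section \<open>Effective weights under blowups\<close>

definition inner_blowup :: "'v wgraph \<Rightarrow> 'v \<Rightarrow> 'v \<Rightarrow> 'v \<Rightarrow> 'v wgraph" where
  "inner_blowup G u a b = \<lparr>verts = insert u (verts G),
     edges = edges G - {#Upair a b#} + {#Upair a u, Upair u b#},
     weight = (\<lambda>v. if v = u then -1 else weight G v - of_bool (v = a) - of_bool (v = b))\<rparr>"

lemma Upair_commute: "Upair a b = Upair b a"
  by simp

text \<open>Every edge joins a vertex to its parent; the symmetry allows its ends to be named
  \<open>v\<close> and \<open>p v\<close> in this order.\<close>

lemma inner_blowup_commute: "inner_blowup G u a b = inner_blowup G u b a"
  unfolding inner_blowup_def Upair_commute[of u] Upair_commute[of a b]
  by (auto simp: add_mset_commute)

definition outer_blowup :: "'v wgraph \<Rightarrow> 'v \<Rightarrow> 'v \<Rightarrow> 'v wgraph" where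
  "outer_blowup G u a = \<lparr>verts = insert u (verts G), edges = edges G + {#Upair a u#},
     weight = (\<lambda>v. if v = u then -1 else weight G v - of_bool (v = a))\<rparr>"

lemma blowup_cases:
  assumes "blowup G H"
  obtains a b u where "Upair a b \<in># edges G" "u \<notin> verts G" "H = inner_blowup G u a b"
  | a u where "a \<in> verts G" "u \<notin> verts G" "H = outer_blowup G u a"
  using assms unfolding inner_blowup_def outer_blowup_def by cases auto

context cycle_forest
begin

lemma edges_minus:
  assumes "v \<in> verts G"
  shows "edges G = add_mset (Upair v (p v))
    (image_mset (\<lambda>v. Upair v (p v)) (mset_set (verts G - {v})))"
  unfolding edges using assms finite_verts
  by (metis (no_types, lifting) image_mset_add_mset mset_set.remove)

lemma edges_inner_blowup:
  assumes v: "v \<in> verts G" and u: "u \<notin> verts G"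
  shows "edges (inner_blowup G u v (p v)) =
    image_mset (\<lambda>y. Upair y ((p(v := u, u := p v)) y)) (mset_set (insert u (verts G)))"
proof -
  let ?p = "p(v := u, u := p v)"
  have "mset_set (insert u (verts G)) = add_mset u (add_mset v (mset_set (verts G - {v})))"
    using assms finite_verts by (simp add: mset_set.remove)
  moreover have "image_mset (\<lambda>y. Upair y (?p y)) (mset_set (verts G - {v}))
      = image_mset (\<lambda>y. Upair y (p y)) (mset_set (verts G - {v}))"
    using assms finite_verts by (intro image_mset_cong) auto
  ultimately show ?thesis using assms edges_minus[OF v]
    by (auto simp: inner_blowup_def add_mset_commute)
qed

text \<open>The weight -1 of the new vertex requires \<open>x u + 1 / (x v - 1) = -1\<close>, whence
  the value \<open>- x v / (x v - 1)\<close>. Its reciprocal is \<open>1 / x v - 1\<close>, so the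
  contribution to \<open>p v\<close> falls by 1 just as the weight of \<open>p v\<close> does, and
  the effective weight there is unchanged.\<close>

lemma inner_blowup_tree:
  assumes v: "v \<in> verts G - set cs" and u: "u \<notin> verts G"
  shows "cycle_forest (inner_blowup G u v (p v)) cs (p(v := u, u := p v))
    (d(u := (d v + d (p v)) / 2)) (x(v := x v - 1, u := - x v / (x v - 1)))"
    (is "cycle_forest ?H cs ?p ?d ?x")
proof
  have pv: "p v \<noteq> v" "p v \<noteq> u" "v \<noteq> u" "p v \<in> verts G"
    using parent_off_cycle v u parent_verts by auto
  have xv: "x v < 0" "d (p v) < d v" using v negative depth by auto
  have ucs: "u \<notin> set cs" using u cycle_subset by auto
  have vH: "verts ?H = insert u (verts G)" by (simp add: inner_blowup_def)
  show "finite (verts ?H)" "cs \<noteq> []" "distinct cs" "set cs \<subseteq> verts ?H"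
    using vH finite_verts cycle_nonempty distinct_cycle cycle_subset by auto
  show "map ?p cs = rotate1 cs"
    using v ucs parent_cycle by (metis (no_types, lifting) DiffD2 fun_upd_other map_cong)
  show "?p y \<in> verts ?H" if "y \<in> verts ?H" for y
    using that vH pv parent_verts by auto
  show "edges ?H = image_mset (\<lambda>v. Upair v (?p v)) (mset_set (verts ?H))"
    unfolding vH using v u by (intro edges_inner_blowup) auto
  show "?d (?p y) < ?d y" if "y \<in> verts ?H - set cs" for y
    using that vH pv xv depth[of y] u parent_verts[of y] by (auto simp: field_simps)
  show "?x y < 0" if "y \<in> verts ?H - set cs" for y
    using that vH pv xv negative[of y] divide_neg_neg[of "x v" "x v - 1"] by auto
  show "?x y \<in> \<int>" if "y \<in> set cs" for y
    using that v ucs integral by auto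
  fix y assume y: "y \<in> verts ?H"
  define T where "T = verts G - set cs - {v}"
  define R where "R y = (\<Sum>c\<in>T. if p c = y then 1 / x c else 0)" for y
  have fT: "finite T" "v \<notin> T" "u \<notin> T" using finite_verts u by (auto simp: T_def)
  have 1: "verts G - set cs = insert v T" and 2: "verts ?H - set cs = insert u (insert v T)"
    using v ucs vH by (auto simp: T_def)
  have G: "weight G y = x y + (if p v = y then 1 / x v else 0) + R y" if "y \<in> verts G" for y
    using weight[OF that] fT unfolding 1 R_def by simp
  have "(\<Sum>c\<in>T. if ?p c = y then 1 / ?x c else 0) = R y"
    unfolding R_def using fT by (intro sum.cong) auto
  then have H: "(\<Sum>c\<in>verts ?H - set cs. if ?p c = y then 1 / ?x c else 0) =
    (if p v = y then 1 / (- x v / (x v - 1)) else 0) + (if u = y then 1 / (x v - 1) else 0) + R y"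
    unfolding 2 using fT pv by auto
  have Ru: "R u = 0" unfolding R_def T_def using u parent_verts by (intro sum.neutral) auto
  consider "y = u" | "y = v" | "y = p v" | "y \<in> verts G" "y \<noteq> u" "y \<noteq> v" "y \<noteq> p v"
    using y vH by auto
  then show "real_of_int (weight ?H y) =
      ?x y + (\<Sum>c\<in>verts ?H - set cs. if ?p c = y then 1 / ?x c else 0)"
    unfolding H
  proof cases
    case 1
    then show "real_of_int (weight ?H y) = ?x y + ((if p v = y then 1 / (- x v / (x v - 1)) else 0)
        + (if u = y then 1 / (x v - 1) else 0) + R y)"
      using Ru xv pv by (simp add: inner_blowup_def field_simps)
  qed (use G[of y] v xv pv in \<open>auto simp: inner_blowup_def field_simps\<close>)
qed

text \<open>With \<open>v\<close> last, \<open>p v\<close> is the head of \<open>cs\<close>, so the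
  new vertex goes in front of the list. No tree changes, and on a loop both decrements hit the same
  vertex.\<close>

lemma inner_blowup_cycle:
  assumes v: "v = last cs" and u: "u \<notin> verts G"
  shows "cycle_forest (inner_blowup G u v (p v)) (u # cs) (p(v := u, u := p v)) d
      (\<lambda>y. if y = u then -1 else x y - of_bool (y = v) - of_bool (y = p v))"
    (is "cycle_forest ?H ?cs ?p d ?x")
    and "map (\<lambda>y. \<lfloor>if y = u then -1 else x y - of_bool (y = v) - of_bool (y = p v)\<rfloor>) (u # cs)
       = blow_seam (map (\<lambda>v. \<lfloor>x v\<rfloor>) cs)"
proof -
  obtain ys where ys: "cs = ys @ [v]" using v cycle_nonempty by (metis append_butlast_last_id)
  have vcs: "v \<in> set cs" using ys by simp
  have ucs: "u \<notin> set cs" using u cycle_subset by auto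
  have cs: "cs = p v # map p ys"
    using parent_cycle by (cases cs) (auto simp: ys)
  show "cycle_forest ?H ?cs ?p d ?x"
  proof
    have vH: "verts ?H = insert u (verts G)" by (simp add: inner_blowup_def)
    have T: "verts ?H - set ?cs = verts G - set cs" using vH u by auto
    have pv: "p v \<in> set cs" "p v \<in> verts G" "v \<in> verts G"
      using parent_in_cycle vcs cycle_subset by auto
    show "finite (verts ?H)" "?cs \<noteq> []" "distinct ?cs" "set ?cs \<subseteq> verts ?H"
      using vH finite_verts distinct_cycle cycle_subset ucs by auto
    have "?p y = p y" if "y \<in> set ys" for y using that ys distinct_cycle ucs by auto
    then have "map ?p ys = map p ys" by (rule map_cong[OF refl])
    moreover have "?p u = p v" "?p v = u" using ucs vcs by auto
    ultimately have "map ?p ?cs = (p v # map p ys) @ [u]" unfolding ys by simp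
    also have "\<dots> = rotate1 ?cs" using cs by simp
    finally show "map ?p ?cs = rotate1 ?cs" .
    show "?p y \<in> verts ?H" if "y \<in> verts ?H" for y
      using that vH pv parent_verts by auto
    show "edges ?H = image_mset (\<lambda>v. Upair v (?p v)) (mset_set (verts ?H))"
      unfolding vH using pv u by (intro edges_inner_blowup) auto
    have off: "y \<noteq> u" "y \<noteq> v" "y \<noteq> p v" if "y \<in> verts G - set cs" for y
      using that pv vcs u by auto
    show "d (?p y) < d y" if "y \<in> verts ?H - set ?cs" for y
      using that unfolding T using off depth by auto
    show "?x y < 0" if "y \<in> verts ?H - set ?cs" for y
      using that unfolding T using off negative by auto
    show "?x y \<in> \<int>" if "y \<in> set ?cs" for y
      using that integral by auto
    fix y assume y: "y \<in> verts ?H"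
    have "(\<Sum>c\<in>verts G - set cs. if ?p c = y then 1 / ?x c else 0)
      = (\<Sum>c\<in>verts G - set cs. if p c = y then 1 / x c else 0)"
      using off by (intro sum.cong) auto
    moreover have "(\<Sum>c\<in>verts G - set cs. if p c = u then 1 / x c else 0) = 0"
      using u parent_verts by (intro sum.neutral) auto
    ultimately show "real_of_int (weight ?H y) =
        ?x y + (\<Sum>c\<in>verts ?H - set ?cs. if ?p c = y then 1 / ?x c else 0)"
      unfolding T using y vH weight[of y] by (cases "y = u") (auto simp: inner_blowup_def)
  qed
  show "map (\<lambda>y. \<lfloor>if y = u then -1 else x y - of_bool (y = v) - of_bool (y = p v)\<rfloor>) (u # cs)
       = blow_seam (map (\<lambda>v. \<lfloor>x v\<rfloor>) cs)"
  proof (cases ys)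
    have floor: "\<lfloor>- 1 :: real\<rfloor> = - 1" by (simp add: floor_eq_iff)
    case Nil
    then show ?thesis using ys cs ucs by (auto simp: blow_seam_simps floor)
  next
    have floor: "\<lfloor>- 1 :: real\<rfloor> = - 1" by (simp add: floor_eq_iff)
    case (Cons a zs)
    have "a = p v" using cs ys Cons by simp
    then have "map (\<lambda>y. \<lfloor>if y = u then -1 else x y - of_bool (y = v) - of_bool (y = p v)\<rfloor>) zs
        = map (\<lambda>v. \<lfloor>x v\<rfloor>) zs"
      using ys Cons ucs distinct_cycle by auto
    then show ?thesis using \<open>a = p v\<close> ys Cons ucs distinct_cycle by (auto simp: blow_seam_simps floor)
  qed
qed

text \<open>A new leaf has effective weight -1 and contributes \<open>1 / (-1)\<close> to
  \<open>a\<close>, matching the drop in the weight of \<open>a\<close>.\<close>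

lemma outer_blowup:
  assumes a: "a \<in> verts G" and u: "u \<notin> verts G"
  shows "cycle_forest (outer_blowup G u a) cs (p(u := a)) (d(u := d a + 1)) (x(u := -1))"
    (is "cycle_forest ?H cs ?p ?d ?x")
proof
  have ucs: "u \<notin> set cs" using u cycle_subset by auto
  have vH: "verts ?H = insert u (verts G)" by (simp add: outer_blowup_def)
  show "finite (verts ?H)" "cs \<noteq> []" "distinct cs" "set cs \<subseteq> verts ?H"
    using vH finite_verts cycle_nonempty distinct_cycle cycle_subset by auto
  show "map ?p cs = rotate1 cs"
    using ucs parent_cycle by (metis (no_types, lifting) fun_upd_other map_cong)
  show "?p y \<in> verts ?H" if "y \<in> verts ?H" for y
    using that vH a parent_verts by auto
  have "image_mset (\<lambda>v. Upair v (?p v)) (mset_set (verts G)) = edges G"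
    unfolding edges using u finite_verts by (intro image_mset_cong) auto
  then show "edges ?H = image_mset (\<lambda>v. Upair v (?p v)) (mset_set (verts ?H))"
    unfolding vH using finite_verts u by (simp add: outer_blowup_def Upair_commute)
  show "?d (?p y) < ?d y" if "y \<in> verts ?H - set cs" for y
    using that vH a u depth[of y] parent_verts[of y] by auto
  show "?x y < 0" if "y \<in> verts ?H - set cs" for y
    using that vH negative[of y] by auto
  show "?x y \<in> \<int>" if "y \<in> set cs" for y
    using that ucs integral by auto
  fix y assume y: "y \<in> verts ?H"
  have T: "verts ?H - set cs = insert u (verts G - set cs)" using vH ucs by auto
  have "(\<Sum>c\<in>verts G - set cs. if ?p c = y then 1 / ?x c else 0)
      = (\<Sum>c\<in>verts G - set cs. if p c = y then 1 / x c else 0)"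
    using u by (intro sum.cong) auto
  moreover have "(\<Sum>c\<in>verts G - set cs. if p c = u then 1 / x c else 0) = 0"
    using u parent_verts by (intro sum.neutral) auto
  ultimately show "real_of_int (weight ?H y) =
      ?x y + (\<Sum>c\<in>verts ?H - set cs. if ?p c = y then 1 / ?x c else 0)"
    unfolding T using y vH weight[of y] u a finite_verts
    by (cases "y = u") (auto simp: outer_blowup_def)
qed

end

lemma has_core_blowup:
  assumes "blowup G H" "has_core G ws"
  shows "\<exists>ws'. has_core H ws' \<and> inner_equiv ws ws'"
proof -
  obtain cs p d x where "cycle_forest G cs p d x" and ws: "ws = map (\<lambda>v. \<lfloor>x v\<rfloor>) cs"
    using assms(2) by (auto simp: has_core_def)
  then interpret cycle_forest G cs p d x by simp
  show ?thesis
    using assms(1)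
  proof (cases rule: blowup_cases)
    case (1 a b u)
    obtain v where v: "v \<in> verts G" and "Upair a b = Upair v (p v)"
      using 1 finite_verts unfolding edges by auto
    then have H: "H = inner_blowup G u v (p v)"
      using 1 inner_blowup_commute by (auto simp: Upair_inject)
    show ?thesis
    proof (cases "v \<in> set cs")
      case False
      have "map (\<lambda>y. \<lfloor>(x(v := x v - 1, u := - x v / (x v - 1))) y\<rfloor>) cs = ws"
        using False 1 cycle_subset ws by auto
      then show ?thesis using inner_blowup_tree[of v u] False v 1 H
        unfolding has_core_def by (metis DiffI inner_equiv_refl)
    next
      case True
      then obtain ys zs where yz: "cs = ys @ v # zs" by (meson split_list)
      define cs' where "cs' = zs @ ys @ [v]"
      have rot: "cs' = rotate (Suc (length ys)) cs"
        using rotate_append[of "ys @ [v]" zs] by (simp add: cs'_def yz)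
      interpret R: cycle_forest G cs' p d x unfolding rot by (rule rotate_cycle)
      have v: "v = last cs'" by (simp add: cs'_def)
      have "has_core H (blow_seam (map (\<lambda>v. \<lfloor>x v\<rfloor>) cs'))"
        unfolding has_core_def H
        by (intro exI conjI, rule R.inner_blowup_cycle(1)[OF v 1(2)],
            rule R.inner_blowup_cycle(2)[OF v 1(2), symmetric])
      moreover have "inner_equiv ws (map (\<lambda>v. \<lfloor>x v\<rfloor>) cs')"
        unfolding ws rot rotate_map[symmetric] by (rule inner_equiv_rotate)
      ultimately show ?thesis
        using inner_equiv_trans inner_equiv_blow_seam R.cycle_nonempty by (metis map_is_Nil_conv)
    qed
  next
    case (2 a u)
    have "map (\<lambda>y. \<lfloor>(x(u := -1)) y\<rfloor>) cs = ws"
      using 2 cycle_subset ws by auto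
    then show ?thesis using outer_blowup[of a u] 2
      unfolding has_core_def by (metis inner_equiv_refl)
  qed
qed

section \<open>Effective weights under blowdowns\<close>

lemma edges_in_verts:
  assumes "weighted_graph G" "u \<notin> verts G"
  shows "filter_mset (\<lambda>e. u \<in> set_uprod e) (edges G) = {#}"
  using assms by (auto simp: weighted_graph_def filter_mset_eq_mempty_iff)

text \<open>The structure is given on the blown-up graph, so the roles of \<open>a\<close> and
  \<open>b\<close> must be read off: \<open>u\<close> has two incident edges, one of them to its
  parent, hence exactly one child.\<close>

lemma inner_blowdown_parent:
  assumes "cycle_forest (inner_blowup G u a b) cs p d x"
    and G: "weighted_graph G" and u: "u \<notin> verts G" and ab: "Upair a b \<in># edges G"
  obtains c where "c \<in> verts G" "p u \<in> verts G" "{y \<in> insert u (verts G). p y = u} = {c}"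
    "Upair c (p u) = Upair a b"
proof -
  define H where "H = inner_blowup G u a b"
  interpret cycle_forest H cs p d x using assms(1) by (simp add: H_def)
  have vH: "verts H = insert u (verts G)" by (simp add: H_def inner_blowup_def)
  have ab': "a \<in> verts G" "b \<in> verts G" using G ab by (auto simp: weighted_graph_def)
  have "filter_mset (\<lambda>e. u \<in> set_uprod e) (edges G - {#Upair a b#}) = {#}"
    unfolding filter_diff_mset edges_in_verts[OF G u] by simp
  then have F: "filter_mset (\<lambda>e. u \<in> set_uprod e) (edges H) = {#Upair a u, Upair u b#}"
    by (simp add: H_def inner_blowup_def)
  have uH: "u \<in> verts H" using vH by simp
  have pu: "p u \<noteq> u"
  proof
    assume "p u = u"
    moreover have "Upair u (p u) \<in># edges H" using uH finite_verts unfolding edges by auto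
    ultimately have "Upair u u \<in># filter_mset (\<lambda>e. u \<in> set_uprod e) (edges H)" by simp
    then show False unfolding F using ab' u by auto
  qed
  define C where "C = {y \<in> verts H. p y = u}"
  have eq: "add_mset (Upair u (p u)) (image_mset (\<lambda>v. Upair v u) (mset_set C)) =
      {#Upair a u, Upair u b#}"
    using incident_edges[OF uH pu] F by (simp add: C_def)
  have "size (mset_set C) = 1" using arg_cong[OF eq, of size] by simp
  then obtain c where C: "C = {c}" by (auto simp: card_1_singleton_iff)
  have "p u = a \<and> c = b \<or> p u = b \<and> c = a"
    using eq u ab' unfolding C by (auto simp: add_eq_conv_ex)
  then show ?thesis using that[of c] ab' C unfolding C_def vH by auto
qed

lemma edges_inner_blowdown:
  assumes "cycle_forest (inner_blowup G u c (p u)) cs p d x" "finite (verts G)"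
    and "u \<notin> verts G" "c \<in> verts G" "p c = u" "Upair c (p u) \<in># edges G"
  shows "edges G = image_mset (\<lambda>v. Upair v ((p(c := p u)) v)) (mset_set (verts G))"
proof -
  let ?H = "inner_blowup G u c (p u)"
  interpret cycle_forest ?H cs p d x by fact
  define M where "M = image_mset (\<lambda>v. Upair v (p v)) (mset_set (verts G - {c}))"
  have "mset_set (insert u (verts G)) = add_mset u (add_mset c (mset_set (verts G - {c})))"
    using assms(2-4) by (simp add: mset_set.remove)
  then have "edges ?H = add_mset (Upair u (p u)) (add_mset (Upair c u) M)"
    using edges assms(5) by (simp add: inner_blowup_def M_def)
  then have "edges G - {#Upair c (p u)#} = M"
    by (simp add: inner_blowup_def add_mset_commute)
  then have "edges G = add_mset (Upair c (p u)) M"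
    using assms(6) by (metis insert_DiffM)
  also have "M = image_mset (\<lambda>v. Upair v ((p(c := p u)) v)) (mset_set (verts G - {c}))"
    unfolding M_def using assms(2) by (intro image_mset_cong) auto
  finally show ?thesis using assms(2,4) by (simp add: mset_set.remove)
qed

lemma inner_blowdown_tree:
  assumes "cycle_forest (inner_blowup G u c (p u)) cs p d x"
    and u: "u \<notin> verts G" "u \<notin> set cs" and c: "{y \<in> insert u (verts G). p y = u} = {c}"
    and pu: "p u \<in> verts G" and e: "Upair c (p u) \<in># edges G"
  shows "cycle_forest G cs (p(c := p u)) d (x(c := x c + 1))" (is "cycle_forest G cs ?p d ?x")
    and "c \<notin> set cs"
proof -
  let ?H = "inner_blowup G u c (p u)"
  interpret H: cycle_forest ?H cs p d x by fact
  have vH: "verts ?H = insert u (verts G)" by (simp add: inner_blowup_def)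
  have cp: "p c = u" "c \<in> insert u (verts G)" using c by auto
  have uniq: "y = c" if "y \<in> verts G" "p y = u" for y using c that by auto
  have uT: "u \<in> verts ?H - set cs" using vH u by simp
  have ppu: "p u \<noteq> u" "p (p u) \<noteq> u" using H.parent_off_cycle[OF uT] by auto
  then have cu: "c \<noteq> u" "c \<noteq> p u" "c \<in> verts G" using cp by auto
  show ccs: "c \<notin> set cs" using H.parent_in_cycle cp u by auto
  have fin: "finite (verts G)" using H.finite_verts vH by simp
  have xu: "x u < 0" "d (p u) < d u" "x c < 0" "d u < d c"
    using H.negative H.depth[OF uT] H.depth[of c] uT cu ccs vH cp by auto
  define T where "T = verts G - set cs - {c}"
  define R where "R y = (\<Sum>v\<in>T. if p v = y then 1 / x v else 0)" for y
  have fT: "finite T" "u \<notin> T" "c \<notin> T" using fin u by (auto simp: T_def)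
  have 1: "verts G - set cs = insert c T" and 2: "verts ?H - set cs = insert u (insert c T)"
    using cu ccs vH u by (auto simp: T_def)
  have W: "weight ?H y = x y + (if p u = y then 1 / x u else 0) + (if u = y then 1 / x c else 0) + R y"
    if "y \<in> verts ?H" for y
    using H.weight[OF that] fT cu cp unfolding 2 R_def by auto
  have "R u = 0" unfolding R_def using uniq by (intro sum.neutral) (auto simp: T_def)
  then have "- 1 = x u + 1 / x c" using W[of u] vH ppu by (simp add: inner_blowup_def)
  then have xu_eq: "x u = - (x c + 1) / x c" using xu by (simp add: field_simps)
  \<comment> \<open>This is \<open>- 1 = x u + 1 / x c\<close> multiplied by \<open>x c\<close>.
    Both effective weights are negative, so \<open>x c\<close> lies below -1 and the new value
    \<open>x c + 1\<close> is still negative.\<close>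
  then have "x c = - 1 - x c * x u" using xu by (simp add: field_simps)
  then have "x c < - 1" using mult_neg_neg[of "x c" "x u"] xu by simp
  show "cycle_forest G cs ?p d ?x"
  proof
    show "finite (verts G)" "cs \<noteq> []" "distinct cs" "set cs \<subseteq> verts G"
      using fin H.cycle_nonempty H.distinct_cycle H.cycle_subset vH u by auto
    have "?p y = p y" if "y \<in> set cs" for y using that ccs by auto
    then show "map ?p cs = rotate1 cs" using H.parent_cycle by (metis map_cong)
    show "?p y \<in> verts G" if "y \<in> verts G" for y
      using that pu uniq H.parent_verts[of y] vH by auto
    show "edges G = image_mset (\<lambda>v. Upair v (?p v)) (mset_set (verts G))"
      by (rule edges_inner_blowdown[OF assms(1) fin u(1) cu(3) cp(1) e])
    show "d (?p y) < d y" if "y \<in> verts G - set cs" for y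
      using that xu H.depth[of y] vH by auto
    show "?x y < 0" if "y \<in> verts G - set cs" for y
      using that \<open>x c < - 1\<close> H.negative[of y] vH by auto
    show "?x y \<in> \<int>" if "y \<in> set cs" for y
      using that ccs H.integral by auto
    fix y assume y: "y \<in> verts G"
    have "(\<Sum>v\<in>T. if ?p v = y then 1 / ?x v else 0) = R y"
      unfolding R_def using fT by (intro sum.cong) auto
    then have S: "(\<Sum>v\<in>verts G - set cs. if ?p v = y then 1 / ?x v else 0)
        = (if p u = y then 1 / (x c + 1) else 0) + R y"
      unfolding 1 using fT by simp
    have "y \<noteq> u" using y u by auto
    moreover have "1 / x u = - x c / (x c + 1)"
      unfolding xu_eq using \<open>x c < - 1\<close> by (simp add: divide_simps algebra_simps)
    ultimately show "real_of_int (weight G y) =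
        ?x y + (\<Sum>v\<in>verts G - set cs. if ?p v = y then 1 / ?x v else 0)"
      unfolding S using W[of y] y vH cu \<open>x c < - 1\<close>
      by (auto simp: inner_blowup_def field_simps)
  qed
qed

text \<open>The only child of \<open>u\<close> is its predecessor on the cycle, so \<open>u\<close>
  carries no tree and its effective weight is its weight -1.\<close>

lemma inner_blowdown_cycle:
  assumes "cycle_forest (inner_blowup G u c (p u)) (u # cs) p d x"
    and u: "u \<notin> verts G" and c: "{y \<in> insert u (verts G). p y = u} = {c}"
    and pu: "p u \<in> verts G" and e: "Upair c (p u) \<in># edges G"
  shows "cycle_forest G cs (p(c := p u)) d (\<lambda>y. x y + of_bool (y = c) + of_bool (y = p u))"
      (is "cycle_forest G cs ?p d ?x")
    and "map (\<lambda>y. \<lfloor>x y\<rfloor>) (u # cs) =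
      blow_seam (map (\<lambda>y. \<lfloor>x y + of_bool (y = c) + of_bool (y = p u)\<rfloor>) cs)"
proof -
  let ?H = "inner_blowup G u c (p u)"
  interpret H: cycle_forest ?H "u # cs" p d x by fact
  have vH: "verts ?H = insert u (verts G)" by (simp add: inner_blowup_def)
  have cp: "p c = u" "c \<in> insert u (verts G)" using c by auto
  have uniq: "y = c" if "y \<in> verts G" "p y = u" for y using c that by auto
  have fin: "finite (verts G)" using H.finite_verts vH by simp
  have ucs: "u \<notin> set cs" using H.distinct_cycle by simp
  \<comment> \<open>On a cycle consisting of \<open>u\<close> alone, \<open>p u\<close> would be
    \<open>u\<close>, which is not a vertex of \<open>G\<close>.\<close>
  have "cs \<noteq> []" using H.parent_cycle pu u by auto
  then obtain ys z where ys: "cs = ys @ [z]" by (metis append_butlast_last_id)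
  have "(p u # map p ys) @ [p z] = cs @ [u]" using H.parent_cycle ys by simp
  then have "p z = u" "p u # map p ys = cs" by (simp_all only: append1_eq_conv)
  moreover have "z \<in> verts G" using H.cycle_subset ys vH H.distinct_cycle by auto
  ultimately have z: "z = c" using uniq by blast
  have cs: "cs = p u # map p ys" using \<open>p u # map p ys = cs\<close> by simp
  have ccs: "c \<in> set cs" "c \<in> verts G" using ys z \<open>z \<in> verts G\<close> by auto
  have pcs: "p u \<in> set cs" by (subst cs) simp
  have T: "verts ?H - set (u # cs) = verts G - set cs" using vH u by auto
  have off: "y \<noteq> u" "y \<noteq> c" "y \<noteq> p u" if "y \<in> verts G - set cs" for y
    using that ccs pcs u by auto
  have "p v \<noteq> u" if "v \<in> verts G - set cs" for v using that uniq ccs(1) by blast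
  then have "(\<Sum>v\<in>verts G - set cs. if p v = u then 1 / x v else 0) = 0"
    by (intro sum.neutral) simp
  then have xu: "x u = - 1" using H.weight[of u] vH unfolding T by (simp add: inner_blowup_def)
  show "cycle_forest G cs ?p d ?x"
  proof
    show "finite (verts G)" "cs \<noteq> []" "distinct cs" "set cs \<subseteq> verts G"
      using fin \<open>cs \<noteq> []\<close> H.distinct_cycle H.cycle_subset vH ucs by auto
    have "?p y = p y" if "y \<in> set ys" for y using that ys z H.distinct_cycle by auto
    then have "map ?p ys = map p ys" by (rule map_cong[OF refl])
    then have "map ?p cs = map p ys @ [p u]" using ys z by simp
    also have "\<dots> = rotate1 cs" using cs by simp
    finally show "map ?p cs = rotate1 cs" .
    show "?p y \<in> verts G" if "y \<in> verts G" for y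
      using that pu uniq H.parent_verts[of y] vH by auto
    show "edges G = image_mset (\<lambda>v. Upair v (?p v)) (mset_set (verts G))"
      by (rule edges_inner_blowdown[OF assms(1) fin u ccs(2) cp(1) e])
    show "d (?p y) < d y" "?x y < 0" if "y \<in> verts G - set cs" for y
      using that off[OF that] H.depth[of y] H.negative[of y] vH by auto
    show "?x y \<in> \<int>" if "y \<in> set cs" for y
      using that H.integral by auto
    fix y assume y: "y \<in> verts G"
    have "(\<Sum>v\<in>verts G - set cs. if ?p v = y then 1 / ?x v else 0)
      = (\<Sum>v\<in>verts G - set cs. if p v = y then 1 / x v else 0)"
      using off by (intro sum.cong) auto
    moreover have "y \<noteq> u" using y u by auto
    ultimately show "real_of_int (weight G y) =
        ?x y + (\<Sum>v\<in>verts G - set cs. if ?p v = y then 1 / ?x v else 0)"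
      using H.weight[of y] y vH unfolding T by (auto simp: inner_blowup_def)
  qed
  have floor: "\<lfloor>- 1 :: real\<rfloor> = - 1" by (simp add: floor_eq_iff)
  show "map (\<lambda>y. \<lfloor>x y\<rfloor>) (u # cs) =
      blow_seam (map (\<lambda>y. \<lfloor>x y + of_bool (y = c) + of_bool (y = p u)\<rfloor>) cs)"
  proof (cases ys)
    case Nil
    then show ?thesis using ys cs z xu by (auto simp: blow_seam_simps floor)
  next
    case (Cons a zs)
    have "a = p u" using cs ys Cons by simp
    then show ?thesis using ys z Cons ucs xu H.distinct_cycle by (auto simp: blow_seam_simps floor)
  qed
qed

text \<open>With a single incident edge \<open>u\<close> has no child, so it lies off the cycle and
  has effective weight -1. Its term at \<open>a\<close> accounts for the weight that
  \<open>a\<close> regains, so the same functions serve for \<open>G\<close>.\<close>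

lemma outer_blowdown:
  assumes "cycle_forest (outer_blowup G u a) cs p d x"
    and G: "weighted_graph G" and u: "u \<notin> verts G" and a: "a \<in> verts G"
  shows "cycle_forest G cs p d x"
proof -
  let ?H = "outer_blowup G u a"
  interpret H: cycle_forest ?H cs p d x by fact
  have vH: "verts ?H = insert u (verts G)" by (simp add: outer_blowup_def)
  have F: "filter_mset (\<lambda>e. u \<in> set_uprod e) (edges ?H) = {#Upair a u#}"
    using edges_in_verts[OF G u] by (simp add: outer_blowup_def)
  have uH: "u \<in> verts ?H" using vH by simp
  have pu: "p u \<noteq> u"
  proof
    assume "p u = u"
    moreover have "Upair u (p u) \<in># edges ?H" using uH H.finite_verts unfolding H.edges by auto
    ultimately have "Upair u u \<in># filter_mset (\<lambda>e. u \<in> set_uprod e) (edges ?H)" by simp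
    then show False unfolding F using a u by auto
  qed
  have eq: "add_mset (Upair u (p u)) (image_mset (\<lambda>v. Upair v u) (mset_set {y \<in> verts ?H. p y = u}))
     = {#Upair a u#}"
    using H.incident_edges[OF uH pu] F by simp
  have "size (mset_set {y \<in> verts ?H. p y = u}) = 0" using arg_cong[OF eq, of size] by simp
  then have none: "p y \<noteq> u" if "y \<in> verts ?H" for y
    using that H.finite_verts by auto
  then have "p u = a" using eq pu a u by (auto simp: mset_set_empty_iff)
  have ucs: "u \<notin> set cs" using none H.parent_image_cycle H.cycle_subset by (metis imageE subsetD)
  have fin: "finite (verts G)" using H.finite_verts vH by simp
  have T: "verts ?H - set cs = insert u (verts G - set cs)" using vH ucs by auto
  have xu: "x u = - 1"
  proof -
    have "(\<Sum>v\<in>verts ?H - set cs. if p v = u then 1 / x v else 0) = 0"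
      using none by (intro sum.neutral) auto
    then show ?thesis using H.weight[OF uH] by (simp add: outer_blowup_def)
  qed
  show ?thesis
  proof
    show "finite (verts G)" "cs \<noteq> []" "distinct cs" "set cs \<subseteq> verts G" "map p cs = rotate1 cs"
      using fin H.cycle_nonempty H.distinct_cycle H.cycle_subset H.parent_cycle vH ucs by auto
    show "p y \<in> verts G" if "y \<in> verts G" for y
      using that none[of y] H.parent_verts[of y] vH by auto
    have "add_mset (Upair u a) (edges G) =
        add_mset (Upair u a) (image_mset (\<lambda>v. Upair v (p v)) (mset_set (verts G)))"
      using H.edges \<open>p u = a\<close> fin u vH by (simp add: outer_blowup_def Upair_commute[of a])
    then show "edges G = image_mset (\<lambda>v. Upair v (p v)) (mset_set (verts G))" by simp
    show "d (p y) < d y" "x y < 0" if "y \<in> verts G - set cs" for y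
      using that H.depth[of y] H.negative[of y] vH by auto
    show "x y \<in> \<int>" if "y \<in> set cs" for y using that by (rule H.integral)
    fix y assume y: "y \<in> verts G"
    then have "y \<noteq> u" using u by auto
    then show "real_of_int (weight G y) =
        x y + (\<Sum>c\<in>verts G - set cs. if p c = y then 1 / x c else 0)"
      using H.weight[of y] y vH fin u xu \<open>p u = a\<close> unfolding T
      by (cases "y = p u") (auto simp: outer_blowup_def)
  qed
qed

lemma has_core_blowdown:
  assumes "blowup G H" "has_core H ws" "weighted_graph G"
  shows "\<exists>ws'. has_core G ws' \<and> inner_equiv ws ws'"
proof -
  obtain cs p d x where H: "cycle_forest H cs p d x" and ws: "ws = map (\<lambda>v. \<lfloor>x v\<rfloor>) cs"
    using assms(2) by (auto simp: has_core_def)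
  show ?thesis
    using assms(1)
  proof (cases rule: blowup_cases)
    case (1 a b u)
    obtain c where c: "c \<in> verts G" "p u \<in> verts G" "{y \<in> insert u (verts G). p y = u} = {c}"
      and cab: "Upair c (p u) = Upair a b"
      using inner_blowdown_parent[of G u a b cs p d x] H assms(3) 1 by metis
    have Hc: "H = inner_blowup G u c (p u)"
      using 1(3) cab inner_blowup_commute by auto
    have e: "Upair c (p u) \<in># edges G" unfolding cab by (rule 1(1))
    show ?thesis
    proof (cases "u \<in> set cs")
      case False
      note tree = inner_blowdown_tree[OF H[unfolded Hc] 1(2) False c(3) c(2) e]
      have "map (\<lambda>y. \<lfloor>(x(c := x c + 1)) y\<rfloor>) cs = ws"
        using tree(2) ws by auto
      then show ?thesis using tree(1) unfolding has_core_def by (metis inner_equiv_refl)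
    next
      case True
      then obtain ys zs where yz: "cs = ys @ u # zs" by (meson split_list)
      define cs' where "cs' = zs @ ys"
      have rot: "u # cs' = rotate (length ys) cs"
        by (simp add: cs'_def yz rotate_append)
      have R: "cycle_forest H (u # cs') p d x"
        unfolding rot by (rule cycle_forest.rotate_cycle[OF H])
      note cyc = inner_blowdown_cycle[OF R[unfolded Hc] 1(2) c(3) c(2) e]
      let ?ws = "map (\<lambda>y. \<lfloor>x y + of_bool (y = c) + of_bool (y = p u)\<rfloor>) cs'"
      have "has_core G ?ws"
        unfolding has_core_def by (intro exI conjI, rule cyc(1), rule refl)
      moreover have "inner_equiv ws (map (\<lambda>v. \<lfloor>x v\<rfloor>) (u # cs'))"
        unfolding ws rot rotate_map[symmetric] by (rule inner_equiv_rotate)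
      moreover have "?ws \<noteq> []" using cycle_forest.cycle_nonempty[OF cyc(1)] by simp
      ultimately show ?thesis unfolding cyc(2)
        using inner_equiv_trans inner_equiv_sym[OF inner_equiv_blow_seam] by blast
    qed
  next
    case (2 a u)
    then show ?thesis using outer_blowdown H assms(3) ws
      unfolding has_core_def by (metis inner_equiv_refl)
  qed
qed

lemma has_core_iso:
  assumes "G \<cong>\<^sub>w H" "has_core G ws"
  shows "has_core H ws"
proof -
  obtain f where f: "bij_betw f (verts G) (verts H)"
    and E: "image_mset (map_uprod f) (edges G) = edges H"
    and W: "\<And>v. v \<in> verts G \<Longrightarrow> Defs.weight H (f v) = Defs.weight G v"
    using assms(1) by (auto simp: wgraph_iso_def)
  obtain cs p d x where "cycle_forest G cs p d x" and ws: "ws = map (\<lambda>v. \<lfloor>x v\<rfloor>) cs"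
    using assms(2) by (auto simp: has_core_def)
  then interpret cycle_forest G cs p d x by simp
  define g where "g = inv_into (verts G) f"
  have inj: "inj_on f (verts G)" and img: "verts H = f ` verts G"
    using f by (auto simp: bij_betw_def)
  have g [simp]: "g (f v) = v" if "v \<in> verts G" for v
    using inj that by (simp add: g_def)
  have csG: "v \<in> verts G" if "v \<in> set cs" for v using that cycle_subset by auto
  have T: "verts H - set (map f cs) = f ` (verts G - set cs)"
    unfolding img using inj_on_image_set_diff[OF inj, of "verts G" "set cs"] cycle_subset by simp
  have "cycle_forest H (map f cs) (f \<circ> p \<circ> g) (d \<circ> g) (x \<circ> g)"
  proof
    show "finite (verts H)" "map f cs \<noteq> []" "set (map f cs) \<subseteq> verts H"
      using img finite_verts cycle_nonempty csG by auto
    show "distinct (map f cs)"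
      using distinct_cycle inj_on_subset[OF inj cycle_subset] by (simp add: distinct_map)
    have "map (f \<circ> p \<circ> g) (map f cs) = map f (map p cs)"
      using csG by simp
    then show "map (f \<circ> p \<circ> g) (map f cs) = rotate1 (map f cs)"
      unfolding parent_cycle by (simp add: rotate1_map)
    show "(f \<circ> p \<circ> g) v \<in> verts H" if "v \<in> verts H" for v
      using that img parent_verts by auto
    have "edges H = image_mset (\<lambda>v. Upair (f v) (f (p v))) (mset_set (verts G))"
      unfolding E[symmetric] edges by (simp add: multiset.map_comp comp_def)
    also have "\<dots> = image_mset (\<lambda>v. Upair (f v) ((f \<circ> p \<circ> g) (f v))) (mset_set (verts G))"
      using finite_verts by (intro image_mset_cong) auto
    also have "\<dots> = image_mset (\<lambda>v. Upair v ((f \<circ> p \<circ> g) v)) (image_mset f (mset_set (verts G)))"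
      by (simp add: multiset.map_comp comp_def)
    also have "image_mset f (mset_set (verts G)) = mset_set (verts H)"
      unfolding img by (rule image_mset_mset_set[OF inj])
    finally show "edges H = image_mset (\<lambda>v. Upair v ((f \<circ> p \<circ> g) v)) (mset_set (verts H))" .
    show "(d \<circ> g) ((f \<circ> p \<circ> g) v) < (d \<circ> g) v" "(x \<circ> g) v < 0"
      if v: "v \<in> verts H - set (map f cs)" for v
      using v depth negative parent_verts unfolding T by auto
    show "(x \<circ> g) v \<in> \<int>" if "v \<in> set (map f cs)" for v
      using that integral csG by auto
    fix v assume "v \<in> verts H"
    then obtain y where y: "v = f y" "y \<in> verts G" using img by auto
    have "(\<Sum>c\<in>verts H - set (map f cs). if (f \<circ> p \<circ> g) c = v then 1 / (x \<circ> g) c else 0)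
        = (\<Sum>c\<in>verts G - set cs. if f (p c) = f y then 1 / x c else 0)"
      unfolding T y using inj_on_subset[OF inj, of "verts G - set cs"]
      by (subst sum.reindex) (auto intro!: sum.cong)
    also have "\<dots> = (\<Sum>c\<in>verts G - set cs. if p c = y then 1 / x c else 0)"
      using y parent_verts inj by (intro sum.cong) (auto dest: inj_onD)
    finally show "real_of_int (Defs.weight H v) = (x \<circ> g) v +
        (\<Sum>c\<in>verts H - set (map f cs). if (f \<circ> p \<circ> g) c = v then 1 / (x \<circ> g) c else 0)"
      using y W weight by simp
  qed
  moreover have "ws = map (\<lambda>v. \<lfloor>(x \<circ> g) v\<rfloor>) (map f cs)"
    unfolding ws using csG by simp
  ultimately show ?thesis unfolding has_core_def by blast
qed

section \<open>Cores of circular graphs\<close>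

lemma cycle_forest_circular:
  assumes "ws \<noteq> []"
  shows "cycle_forest (circular ws) [0..<length ws] (\<lambda>i. Suc i mod length ws) (\<lambda>_. 0) (\<lambda>i. ws ! i)"
proof
  show "map (\<lambda>i. Suc i mod length ws) [0..<length ws] = rotate1 [0..<length ws]"
    using assms by (intro nth_equalityI) (auto simp: nth_rotate1)
  show "edges (circular ws) =
      image_mset (\<lambda>v. Upair v (Suc v mod length ws)) (mset_set (verts (circular ws)))"
    by (simp add: circular_def mset_upt lessThan_atLeast0)
qed (use assms in \<open>auto simp: circular_def lessThan_atLeast0\<close>)

lemma has_core_circular:
  assumes "ws \<noteq> []"
  shows "has_core (circular ws) ws"
  unfolding has_core_def
  by (intro exI conjI, rule cycle_forest_circular[OF assms]) (simp add: map_nth)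

lemma birational_core:
  assumes "birational G H" "has_core G ws"
  shows "\<exists>ws'. has_core H ws' \<and> inner_equiv ws ws'"
  using assms(1) unfolding birational_def
proof (induction rule: rtranclp_induct)
  case base
  then show ?case using assms(2) inner_equiv_refl by blast
next
  case (step H K)
  then obtain ws' where ws': "has_core H ws'" "inner_equiv ws ws'" by blast
  have "\<exists>ws''. has_core K ws'' \<and> inner_equiv ws' ws''"
    using step.hyps(2) ws'(1) has_core_iso has_core_blowup has_core_blowdown inner_equiv_refl
    unfolding birational_step_def by metis
  then show ?case using ws'(2) inner_equiv_trans by blast
qed

lemma map_nth_cyclic:
  assumes "length cs = length bs" "bs \<noteq> []" "cs ! 0 < length bs"
    and succ: "\<And>i. Suc i < length bs \<Longrightarrow> cs ! Suc i = Suc (cs ! i) mod length bs"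
  shows "map (\<lambda>v. bs ! v) cs = rotate (cs ! 0) bs"
proof -
  have cs: "cs ! i = (cs ! 0 + i) mod length bs" if "i < length bs" for i
    using that
  proof (induction i)
    case 0
    then show ?case using assms(3) by simp
  next
    case (Suc i)
    have "cs ! Suc i = Suc (cs ! i) mod length bs" using Suc.prems by (rule succ)
    also have "cs ! i = (cs ! 0 + i) mod length bs" using Suc by simp
    finally show ?case by (simp only: mod_Suc_eq add_Suc_right)
  qed
  show ?thesis
  proof (rule nth_equalityI)
    fix i assume "i < length (map (\<lambda>v. bs ! v) cs)"
    then have i: "i < length bs" using assms(1) by simp
    then show "map (\<lambda>v. bs ! v) cs ! i = rotate (cs ! 0) bs ! i"
      using nth_rotate[OF i, of "cs ! 0"] cs[OF i] assms(1) by (simp add: i)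
  qed (use assms(1) in simp)
qed

text \<open>A vertex off the cycle of maximal rank would be a leaf, but every vertex has degree two.\<close>

lemma cycle_forest_circular_spanning:
  assumes "cycle_forest (circular bs) cs p d x" "bs \<noteq> []"
  shows "set cs = {..<length bs}"
proof (rule ccontr)
  define n where "n = length bs"
  interpret cycle_forest "circular bs" cs p d x by fact
  \<comment> \<open>The obvious structure on the same graph provides a second count of the edges at
    \<open>u\<close>.\<close>
  interpret C: cycle_forest "circular bs" "[0..<length bs]" "\<lambda>i. Suc i mod length bs" "\<lambda>_. 0" "\<lambda>i. bs ! i"
    using assms(2) by (rule cycle_forest_circular)
  have V: "verts (circular bs) = {..<n}" by (simp add: circular_def n_def)
  assume "set cs \<noteq> {..<length bs}"
  then have ne: "{..<n} - set cs \<noteq> {}" using cycle_subset V n_def by auto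
  then have "card (set cs) < n"
    using psubset_card_mono[of "{..<n}" "set cs"] cycle_subset V by auto
  moreover have "card (set cs) > 0" using cycle_nonempty by (simp add: card_gt_0_iff)
  ultimately have n: "n \<ge> 2" by simp
  obtain u where u: "u \<in> {..<n} - set cs" and max: "\<And>y. y \<in> {..<n} - set cs \<Longrightarrow> d y \<le> d u"
  proof -
    have "Max (d ` ({..<n} - set cs)) \<in> d ` ({..<n} - set cs)" using ne by (intro Max_in) auto
    then show ?thesis using that by (metis (no_types, lifting) Max_ge finite_Diff finite_imageI
        finite_lessThan imageE image_eqI)
  qed
  have "p y \<noteq> u" if "y < n" for y
  proof
    assume "p y = u"
    then have "y \<in> {..<n} - set cs" using u that parent_in_cycle by auto
    then show False using depth[of y] max[of y] \<open>p y = u\<close> V by auto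
  qed
  then have "{y \<in> verts (circular bs). p y = u} = {}" "p u \<noteq> u" using V u by auto
  then have 1: "size (filter_mset (\<lambda>e. u \<in> set_uprod e) (edges (circular bs))) = 1"
    using incident_edges[of u] V u by simp
  have "Suc u mod n \<noteq> u" using n u by (auto simp: mod_Suc)
  then have "size (filter_mset (\<lambda>e. u \<in> set_uprod e) (edges (circular bs))) =
      Suc (card {y \<in> {..<n}. Suc y mod n = u})"
    using C.incident_edges[of u] V u n_def by simp
  \<comment> \<open>The predecessor of \<open>u\<close> on the circle is a child in the obvious
    structure, so at least two edges meet \<open>u\<close>.\<close>
  moreover have "(if u = 0 then n - 1 else u - 1) \<in> {y \<in> {..<n}. Suc y mod n = u}"
    using n u by auto
  then have "card {y \<in> {..<n}. Suc y mod n = u} \<noteq> 0" by (auto simp: card_eq_0_iff)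
  ultimately show False using 1 by simp
qed

text \<open>No vertex is left for trees, so effective weights are the weights, and only starting
  point and direction of \<open>cs\<close> remain open.\<close>

lemma core_circular:
  assumes "has_core (circular bs) ws" "bs \<noteq> []"
  shows "\<exists>m. ws = rotate m bs \<or> ws = rev (rotate m bs)"
proof -
  obtain cs p d x where cf: "cycle_forest (circular bs) cs p d x"
    and ws: "ws = map (\<lambda>v. \<lfloor>x v\<rfloor>) cs"
    using assms(1) by (auto simp: has_core_def)
  interpret cycle_forest "circular bs" cs p d x by fact
  define n where "n = length bs"
  define s where "s i = Suc i mod n" for i
  have V: "verts (circular bs) = {..<n}" by (simp add: circular_def n_def)
  have cs: "set cs = {..<n}" using cycle_forest_circular_spanning[OF cf assms(2)] n_def by simp
  then have len: "length cs = n" using distinct_cycle distinct_card by fastforce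
  have npos: "n > 0" using assms(2) by (simp add: n_def)
  have "x v = bs ! v" if "v < n" for v
    using weight[of v] that by (simp add: cs V) (simp add: circular_def)
  then have ws: "ws = map (\<lambda>v. bs ! v) cs" unfolding ws using cs by auto
  \<comment> \<open>Periodic extension of \<open>cs\<close>, so that the step across the seam is
    like every other.\<close>
  define q where "q i = cs ! (i mod n)" for i
  have q: "q i < n" for i using cs len npos nth_mem[of "i mod n" cs] by (auto simp: q_def)
  have qp: "q (Suc i) = p (q i)" for i
  proof -
    have "p (cs ! (i mod n)) = rotate1 cs ! (i mod n)"
      using parent_cycle len npos by (metis mod_less_divisor nth_map)
    then show ?thesis using len npos by (simp add: q_def nth_rotate1 mod_Suc_eq)
  qed
  have adj: "p v = s v \<or> s (p v) = v" if "v < n" for v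
  proof -
    have "Upair v (p v) \<in># edges (circular bs)"
      using that V finite_verts unfolding edges by auto
    then show ?thesis by (auto simp: circular_def s_def n_def)
  qed
  \<comment> \<open>With at most two vertices both directions agree. From three on, two consecutive
    steps never return to their start, so the direction of the first step persists.\<close>
  have dir: "(\<forall>i. q (Suc i) = s (q i)) \<or> (\<forall>i. s (q (Suc i)) = q i)"
  proof (cases "n \<ge> 3")
    case False
    then consider "n = 1" | "n = 2" using npos by linarith
    then have "p v = s v" if "v < n" for v
      using adj[OF that] that parent_verts[of v] V
      by cases (auto simp: s_def mod_Suc split: if_splits)
    then show ?thesis using qp q by simp
  next
    case True
    have no_turn: "q (Suc (Suc i)) \<noteq> q i" for i
    proof -
      have "Suc (Suc i) mod n \<noteq> i mod n"
        using True mod_eq_dvd_iff_nat[of i "Suc (Suc i)" n] by (auto dest: dvd_imp_le)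
      then show ?thesis
        using distinct_cycle len npos by (simp add: q_def nth_eq_iff_index_eq)
    qed
    have dirs: "q (Suc i) = s (q i) \<or> s (q (Suc i)) = q i" for i
      using adj[OF q] qp by simp
    show ?thesis
    proof (cases "q (Suc 0) = s (q 0)")
      case True
      have "q (Suc i) = s (q i)" for i
      proof (induction i)
        case (Suc i)
        have "s y = s z \<longleftrightarrow> y = z" if "y < n" "z < n" for y z
          using that by (auto simp: s_def mod_Suc split: if_splits)
        then show ?case using Suc dirs[of "Suc i"] no_turn[of i] q by metis
      qed (rule True)
      then show ?thesis by blast
    next
      case False
      have "s (q (Suc i)) = q i" for i
      proof (induction i)
        case (Suc i)
        then show ?case using dirs[of "Suc i"] no_turn[of i] by metis
      qed (use False dirs in blast)
      then show ?thesis by blast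
    qed
  qed
  then show ?thesis
  proof
    assume A: "\<forall>i. q (Suc i) = s (q i)"
    have "cs ! Suc i = Suc (cs ! i) mod length bs" if "Suc i < length bs" for i
      using A[rule_format, of i] that by (simp add: q_def s_def n_def)
    moreover have "cs ! 0 < length bs" using q[of 0] npos by (simp add: q_def n_def)
    ultimately have "ws = rotate (cs ! 0) bs"
      unfolding ws using len assms(2) n_def by (intro map_nth_cyclic) auto
    then show ?thesis by blast
  next
    assume A: "\<forall>i. s (q (Suc i)) = q i"
    have "rev cs ! Suc i = Suc (rev cs ! i) mod length bs" if i: "Suc i < length bs" for i
    proof -
      have "Suc (n - Suc (Suc i)) = n - Suc i" using i by (simp add: n_def)
      then show ?thesis
        using A[rule_format, of "n - Suc (Suc i)"] i len
        by (simp add: q_def s_def n_def rev_nth)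
    qed
    moreover have "rev cs ! 0 < length bs"
      using q[of "n - 1"] npos len by (simp add: q_def n_def rev_nth)
    ultimately have "map (\<lambda>v. bs ! v) (rev cs) = rotate (rev cs ! 0) bs"
      using len assms(2) n_def by (intro map_nth_cyclic) auto
    then have "ws = rev (rotate (rev cs ! 0) bs)"
      unfolding ws by (metis rev_map rev_rev_ident)
    then show ?thesis by blast
  qed
qed

section \<open>Uniqueness of standard circular graphs\<close>

lemma zeros_prefix_unique:
  fixes as bs :: "int list"
  assumes "replicate m 0 @ as = replicate n 0 @ bs"
    and "\<forall>a\<in>set as. a \<noteq> 0" "\<forall>b\<in>set bs. b \<noteq> 0"
  shows "m = n \<and> as = bs"
proof -
  have "takeWhile (\<lambda>a. a = 0) as = []" "takeWhile (\<lambda>b. b = 0) bs = []"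
    using assms(2,3) by (cases as; cases bs; auto)+
  then have "replicate m (0 :: int) = replicate n 0"
    using arg_cong[OF assms(1), of "takeWhile (\<lambda>a. a = 0)"] by (simp add: takeWhile_append)
  then show ?thesis using assms(1) by (metis length_replicate same_append_eq)
qed

lemma inner_equiv_rev_rotate: "inner_equiv (rev (rotate m ws)) (rev ws)"
  using inner_equiv_append[of "rev (take (m mod length ws) ws)" "rev (drop (m mod length ws) ws)"]
  by (simp add: rotate_drop_take flip: rev_append)

text \<open>Reversal moves the zeros to the end and a rotation brings them back. The tails
  \<open>[w]\<close> and \<open>[-1, -1]\<close> are palindromes, so only a chain can
  change.\<close>

lemma standard_rev:
  assumes "bs \<in> standard_seqs"
  obtains bs' where "bs' \<in> standard_seqs" "inner_equiv (rev bs) bs'"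
    "bs' = bs \<or> (\<exists>k as. (\<forall>a\<in>set as. a \<le> - 2) \<and>
       bs = replicate (2 * k) 0 @ as \<and> bs' = replicate (2 * k) 0 @ rev as)"
  using assms
proof cases
  case (1 as k)
  have "replicate (2 * k) 0 @ rev as \<in> standard_seqs"
    using 1 by (intro standard_seqs.intros) auto
  then show ?thesis
    using that 1 inner_equiv_append[of "rev as" "replicate (2 * k) 0"] by auto
next
  case (2 w l)
  show ?thesis
    using that[of bs] assms 2 inner_equiv_append[of "[w]" "replicate l 0"] by auto
next
  case (3 k)
  show ?thesis
    using that[of bs] assms 3 inner_equiv_append[of "[- 1, - 1]" "replicate (2 * k) 0"] by auto
qed

text \<open>Common source of the three claims. If the core reads \<open>bs\<close> backwards,
  \<open>standard_unique\<close> is applied to the standard form \<open>bs'\<close> of the reversal,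
  and its result is reversed back.\<close>

lemma standard_birational:
  assumes as: "as \<in> standard_seqs" and "standard_circular B" "birational (circular as) B"
  obtains bs where "B \<cong>\<^sub>w circular bs"
    "bs = as \<or> (\<exists>k as' m. as' \<noteq> [] \<and> (\<forall>a\<in>set as'. a \<le> - 2) \<and>
       as = replicate (2 * k) 0 @ as' \<and>
       (bs = replicate (2 * k) 0 @ rotate m as' \<or> bs = replicate (2 * k) 0 @ rev (rotate m as')))"
proof -
  obtain bs where bs: "bs \<in> standard_seqs" and B: "B \<cong>\<^sub>w circular bs"
    using assms(2) by (auto simp: standard_circular_def)
  have ne: "as \<noteq> []" "bs \<noteq> []" using as bs by (auto elim: standard_seqs.cases)
  obtain ws where "has_core B ws" and ws: "inner_equiv as ws"
    using birational_core[OF assms(3) has_core_circular[OF ne(1)]] by blast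
  then obtain m where "ws = rotate m bs \<or> ws = rev (rotate m bs)"
    using has_core_iso[OF B] core_circular ne(2) by blast
  then show ?thesis
  proof
    assume "ws = rotate m bs"
    then have "inner_equiv as bs"
      using ws inner_equiv_rotate inner_equiv_sym inner_equiv_trans by blast
    from standard_unique[OF as bs this] show ?thesis using that[OF B] by blast
  next
    assume rev: "ws = rev (rotate m bs)"
    obtain bs' where bs': "bs' \<in> standard_seqs" "inner_equiv (rev bs) bs'"
      and or: "bs' = bs \<or> (\<exists>k as. (\<forall>a\<in>set as. a \<le> - 2) \<and>
       bs = replicate (2 * k) 0 @ as \<and> bs' = replicate (2 * k) 0 @ rev as)"
      using standard_rev[OF bs] by metis
    have "inner_equiv as bs'"
      using ws bs'(2) inner_equiv_rev_rotate inner_equiv_trans unfolding rev by blast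
    note unique = standard_unique[OF as bs'(1) this]
    from or show ?thesis
    proof
      assume "bs' = bs"
      then show ?thesis using unique that[OF B] by blast
    next
      assume "\<exists>k as. (\<forall>a\<in>set as. a \<le> - 2) \<and>
        bs = replicate (2 * k) 0 @ as \<and> bs' = replicate (2 * k) 0 @ rev as"
      then obtain k cs where cs: "\<forall>a\<in>set cs. a \<le> - 2" "bs = replicate (2 * k) 0 @ cs"
        "bs' = replicate (2 * k) 0 @ rev cs" by blast
      from unique show ?thesis
      proof
        assume eq: "as = bs'"
        show ?thesis
        proof (cases "cs = []")
          case True
          then show ?thesis using that[OF B] eq cs by simp
        next
          case False
          have "bs = replicate (2 * k) 0 @ rev (rotate 0 (rev cs))" using cs by simp
          then show ?thesis using that[OF B] eq cs False
            by (metis rev_is_Nil_conv set_rev)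
        qed
      next
        assume "\<exists>k as' m. as' \<noteq> [] \<and> (\<forall>a\<in>set as'. a \<le> - 2) \<and>
           as = replicate (2 * k) 0 @ as' \<and> bs' = replicate (2 * k) 0 @ rotate m as'"
        then obtain k' as' m' where as': "as' \<noteq> []" "\<forall>a\<in>set as'. a \<le> - 2"
           "as = replicate (2 * k') 0 @ as'" "bs' = replicate (2 * k') 0 @ rotate m' as'" by blast
        \<comment> \<open>Chains have no zero entries, so both decompositions of \<open>bs'\<close>
          split off the same zeros.\<close>
        have "2 * k = 2 * k' \<and> rev cs = rotate m' as'"
          using cs as' by (intro zeros_prefix_unique) auto
        then have "bs = replicate (2 * k') 0 @ rev (rotate m' as')"
          using cs by (metis rev_rev_ident)
        then show ?thesis using that[OF B] as' by blast
      qed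
    qed
  qed
qed

theorem corollary3p28:
  shows "(\<forall>(k::nat) (as::int list) (B::nat wgraph).
            (k > 0 \<or> as \<noteq> []) \<longrightarrow> (\<forall>a \<in> set as. a \<le> -2) \<longrightarrow>
            standard_circular B \<longrightarrow> birational (circular (replicate (2 * k) 0 @ as)) B \<longrightarrow>
            (\<exists>as'. (\<exists>m. as' = rotate m as \<or> as' = rev (rotate m as)) \<and>
                   B \<cong>\<^sub>w circular (replicate (2 * k) 0 @ as'))) \<and>
         (\<forall>(l::nat) (w::int) (B::nat wgraph).
            w \<le> 0 \<longrightarrow>
            standard_circular B \<longrightarrow> birational (circular (replicate l 0 @ [w])) B \<longrightarrow>
            B \<cong>\<^sub>w circular (replicate l 0 @ [w])) \<and>
         (\<forall>(k::nat) (B::nat wgraph).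
            k \<ge> 1 \<longrightarrow>
            standard_circular B \<longrightarrow> birational (circular (replicate (2 * k) 0 @ [-1, -1])) B \<longrightarrow>
            B \<cong>\<^sub>w circular (replicate (2 * k) 0 @ [-1, -1]))"
proof (intro conjI allI impI)
  fix k and as :: "int list" and B :: "nat wgraph"
  assume ne: "k > 0 \<or> as \<noteq> []" and neg: "\<forall>a \<in> set as. a \<le> -2"
    and B: "standard_circular B" "birational (circular (replicate (2 * k) 0 @ as)) B"
  have "replicate (2 * k) 0 @ as \<in> standard_seqs"
  \<comment> \<open>For empty \<open>as\<close> the graph \<open>((0_{2k}))\<close> is standard
    through the second form, as \<open>2 * k - 1\<close> zeros followed by the weight 0.\<close>
  proof (cases "as = []")
    case True
    then have "2 * k = Suc (2 * k - 1)" using ne by simp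
    then have "replicate (2 * k) 0 @ as = replicate (2 * k - 1) 0 @ [0]"
      using True by (metis append_Nil2 replicate_Suc replicate_append_same)
    then show ?thesis by (simp add: standard_seqs.intros(2))
  next
    case False
    then show ?thesis using neg by (rule standard_seqs.intros(1))
  qed
  from standard_birational[OF this B] obtain bs where bs: "B \<cong>\<^sub>w circular bs"
    "bs = replicate (2 * k) 0 @ as \<or> (\<exists>k' as' m. as' \<noteq> [] \<and> (\<forall>a\<in>set as'. a \<le> - 2) \<and>
       replicate (2 * k) 0 @ as = replicate (2 * k') 0 @ as' \<and>
       (bs = replicate (2 * k') 0 @ rotate m as' \<or> bs = replicate (2 * k') 0 @ rev (rotate m as')))" .
  from bs(2) show "\<exists>as'. (\<exists>m. as' = rotate m as \<or> as' = rev (rotate m as)) \<and>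
                   B \<cong>\<^sub>w circular (replicate (2 * k) 0 @ as')"
  proof
    assume "bs = replicate (2 * k) 0 @ as"
    then show ?thesis using bs(1) by (intro exI[of _ as] conjI exI[of _ 0]) simp_all
  next
    assume "\<exists>k' as' m. as' \<noteq> [] \<and> (\<forall>a\<in>set as'. a \<le> - 2) \<and>
       replicate (2 * k) 0 @ as = replicate (2 * k') 0 @ as' \<and>
       (bs = replicate (2 * k') 0 @ rotate m as' \<or> bs = replicate (2 * k') 0 @ rev (rotate m as'))"
    then obtain k' as' m where as': "\<forall>a\<in>set as'. a \<le> - 2"
      "replicate (2 * k) 0 @ as = replicate (2 * k') 0 @ as'"
      "bs = replicate (2 * k') 0 @ rotate m as' \<or> bs = replicate (2 * k') 0 @ rev (rotate m as')"
      by blast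
    have "2 * k = 2 * k' \<and> as = as'"
      using neg as'(1,2) by (intro zeros_prefix_unique) auto
    then show ?thesis using as'(3) bs(1) by auto
  qed
next
  fix l and w :: int and B :: "nat wgraph"
  assume w: "w \<le> 0"
    and B: "standard_circular B" "birational (circular (replicate l 0 @ [w])) B"
  from standard_birational[OF standard_seqs.intros(2)[OF w] B] obtain bs where
    bs: "B \<cong>\<^sub>w circular bs"
    "bs = replicate l 0 @ [w] \<or> (\<exists>k as m. as \<noteq> [] \<and> (\<forall>a\<in>set as. a \<le> - 2) \<and>
       replicate l 0 @ [w] = replicate (2 * k) 0 @ as \<and>
       (bs = replicate (2 * k) 0 @ rotate m as \<or> bs = replicate (2 * k) 0 @ rev (rotate m as)))" .
  from bs(2) have "bs = replicate l 0 @ [w]"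
  proof
    assume "\<exists>k as m. as \<noteq> [] \<and> (\<forall>a\<in>set as. a \<le> - 2) \<and>
       replicate l 0 @ [w] = replicate (2 * k) 0 @ as \<and>
       (bs = replicate (2 * k) 0 @ rotate m as \<or> bs = replicate (2 * k) 0 @ rev (rotate m as))"
    then obtain k as m where as: "as \<noteq> []" "\<forall>a\<in>set as. a \<le> - 2"
      "replicate l 0 @ [w] = replicate (2 * k) 0 @ as"
      "bs = replicate (2 * k) 0 @ rotate m as \<or> bs = replicate (2 * k) 0 @ rev (rotate m as)"
      by blast
    \<comment> \<open>A nonzero last entry fixes the zero prefix, so the chain is
      \<open>[w]\<close>, which rotation and reversion leave alone.\<close>
    have "w = last as" using as(1) arg_cong[OF as(3), of last] by simp
    then have "w \<noteq> 0" using as(2) last_in_set[OF as(1)] by auto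
    then have "l = 2 * k \<and> [w] = as"
      using as(2,3) by (intro zeros_prefix_unique) auto
    then show ?thesis using as(4) by auto
  qed
  then show "B \<cong>\<^sub>w circular (replicate l 0 @ [w])" using bs(1) by simp
next
  fix k and B :: "nat wgraph"
  assume B: "standard_circular B" "birational (circular (replicate (2 * k) 0 @ [-1, -1])) B"
  from standard_birational[OF standard_seqs.intros(3) B] obtain bs where
    bs: "B \<cong>\<^sub>w circular bs"
    "bs = replicate (2 * k) 0 @ [- 1, - 1] \<or> (\<exists>k' as m. as \<noteq> [] \<and> (\<forall>a\<in>set as. a \<le> - 2) \<and>
       replicate (2 * k) 0 @ [- 1, - 1] = replicate (2 * k') 0 @ as \<and>
       (bs = replicate (2 * k') 0 @ rotate m as \<or> bs = replicate (2 * k') 0 @ rev (rotate m as)))" .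
  \<comment> \<open>The last entry -1 cannot occur in a chain, which rules out the second
    alternative.\<close>
  have "replicate (2 * k) 0 @ [- 1, - 1] \<noteq> replicate (2 * k') 0 @ as"
    if "as \<noteq> []" "\<forall>a\<in>set as. a \<le> - 2" for k' and as :: "int list"
  proof
    assume "replicate (2 * k) 0 @ [- 1, - 1] = replicate (2 * k') 0 @ as"
    from arg_cong[OF this, of last] have "last as = - 1" using that by simp
    then show False using that(2) last_in_set[OF that(1)] by auto
  qed
  then have "bs = replicate (2 * k) 0 @ [- 1, - 1]" using bs(2) by blast
  then show "B \<cong>\<^sub>w circular (replicate (2 * k) 0 @ [-1, -1])" using bs(1) by simp
qed

end
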